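(* Let $\mu:(A,\Omega)\to V$ be a symplectic principal $\mathbb R$-bundle. Then there exists a unique Poisson structure $\{\cdot,\cdot\}_V$ on $V$ such that $\mu$ is a Poisson map, i.e. $$\{f\circ\mu,f'\circ\mu\}_A=\{f,f'\}_V\circ\mu,\qquad\text{for any }f,f'\in C^\infty(V),$$ where $\{\cdot,\cdot\}_A$ is the Poisson bracket on $A$ induced by the symplectic form $\Omega$.
   Context: A principal $\mathbb R$-bundle $\mu:A\to V$ is a principal bundle with structure group $(\mathbb R,+)$ and principal action $\psi:\mathbb R\times A\to A$. A symplectic principal $\mathbb R$-bundle $\mu:(A,\Omega)\to V$ is a principal $\mathbb R$-bundle with a symplectic form $\Omega$ on $A$ such that $\psi_s^*\Omega=\Omega$ for all $s\in\mathbb R$. The Hamiltonian vector field of $F\in C^\infty(A)$ is given by $i_{\mathcal H_F}\Omega=dF$, and $\{F,F'\}_A=\Omega(\mathcal H_F,\mathcal H_{F'})$. *)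

theory Defs
  imports "HOL-Analysis.Analysis"
begin

section \<open>Smooth maps between open subsets of Euclidean spaces\<close>

primrec Ck_on :: "nat \<Rightarrow> 'e::real_normed_vector set \<Rightarrow> ('e \<Rightarrow> 'f::real_normed_vector) \<Rightarrow> bool" where
  "Ck_on 0 S f \<longleftrightarrow> continuous_on S f"
| "Ck_on (Suc k) S f \<longleftrightarrow>
     (\<forall>x\<in>S. f differentiable (at x)) \<and> (\<forall>v. Ck_on k S (\<lambda>x. frechet_derivative f (at x) v))"

text \<open>Intended for open \<open>S\<close> and finite-dimensional spaces only.\<close>

definition smooth_on :: "'e::euclidean_space set \<Rightarrow> ('e \<Rightarrow> 'f::euclidean_space) \<Rightarrow> bool" where
  "smooth_on S f \<longleftrightarrow> (\<forall>k. Ck_on k S f)"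


section \<open>Smooth manifolds\<close>

text \<open>
  The underlying topological space of a manifold is a type; the manifold is given by an atlas on
  it. The atlas need not be maximal: all notions below depend only on the smooth structure it
  generates. In a chart \<open>(U, \<phi>)\<close> only the values of \<open>\<phi>\<close> on \<open>U\<close> matter.
\<close>

type_synonym ('a, 'e) chart = "'a set \<times> ('a \<Rightarrow> 'e)"

definition chart_inv :: "('a, 'e) chart \<Rightarrow> 'e \<Rightarrow> 'a" where
  "chart_inv c = inv_into (fst c) (snd c)"

definition chart_image :: "('a, 'e) chart \<Rightarrow> 'e set" where
  "chart_image c = snd c ` fst c"

definition is_chart :: "('a::topological_space, 'e::euclidean_space) chart \<Rightarrow> bool" where
  "is_chart c \<longleftrightarrow> open (fst c) \<and> open (chart_image c) \<and>
     homeomorphism (fst c) (chart_image c) (snd c) (chart_inv c)"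

definition smooth_manifold ::
  "('a::{t2_space,second_countable_topology}, 'e::euclidean_space) chart set \<Rightarrow> bool" where
  "smooth_manifold M \<longleftrightarrow>
     (\<forall>c\<in>M. is_chart c) \<and>
     (\<Union>c\<in>M. fst c) = UNIV \<and>
     (\<forall>c\<in>M. \<forall>d\<in>M. smooth_on (snd c ` (fst c \<inter> fst d)) (snd d \<circ> chart_inv c))"

definition real_atlas :: "(real, real) chart set" where
  "real_atlas = {(UNIV, id)}"

definition prod_atlas ::
  "('a, 'e) chart set \<Rightarrow> ('b, 'f) chart set \<Rightarrow> ('a \<times> 'b, 'e \<times> 'f) chart set" where
  "prod_atlas M N = {(fst c \<times> fst d, map_prod (snd c) (snd d)) | c d. c \<in> M \<and> d \<in> N}"

text \<open>\<open>S\<close> is meant to be open, regarded as an open submanifold of \<open>M\<close>.\<close>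

definition smooth_map_on ::
  "('a::topological_space, 'e::euclidean_space) chart set \<Rightarrow>
   ('b::topological_space, 'f::euclidean_space) chart set \<Rightarrow> 'a set \<Rightarrow> ('a \<Rightarrow> 'b) \<Rightarrow> bool" where
  "smooth_map_on M N S f \<longleftrightarrow> continuous_on S f \<and>
     (\<forall>c\<in>M. \<forall>d\<in>N. smooth_on (snd c ` (fst c \<inter> S \<inter> f -` fst d)) (snd d \<circ> f \<circ> chart_inv c))"

definition diffeomorphism_on ::
  "('a::topological_space, 'e::euclidean_space) chart set \<Rightarrow>
   ('b::topological_space, 'f::euclidean_space) chart set \<Rightarrow>
   'a set \<Rightarrow> 'b set \<Rightarrow> ('a \<Rightarrow> 'b) \<Rightarrow> bool" where
  "diffeomorphism_on M N S T f \<longleftrightarrow> bij_betw f S T \<and>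
     smooth_map_on M N S f \<and> smooth_map_on N M T (inv_into S f)"

definition smooth_functions ::
  "('a::topological_space, 'e::euclidean_space) chart set \<Rightarrow> ('a \<Rightarrow> real) set" where
  "smooth_functions M = {f. smooth_map_on M real_atlas UNIV f}"


section \<open>Tangent vectors, vector fields and 2-forms\<close>

text \<open>
  A tangent vector at \<open>p\<close> is the family \<open>v\<close> of its coordinate vectors \<open>v c\<close>, one for each chart
  \<open>c\<close> around \<open>p\<close>, related by the derivatives of the transition maps. The value \<open>0\<close> at all other
  arguments makes the representation unique. The vector space operations are pointwise.
\<close>

definition tangent_space ::
  "('a, 'e::euclidean_space) chart set \<Rightarrow> 'a \<Rightarrow> (('a, 'e) chart \<Rightarrow> 'e) set" where
  "tangent_space M p = {v.
     (\<forall>c\<in>M. \<forall>d\<in>M. p \<in> fst c \<inter> fst d \<longrightarrow>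
        v d = frechet_derivative (snd d \<circ> chart_inv c) (at (snd c p)) (v c)) \<and>
     (\<forall>c. c \<notin> M \<or> p \<notin> fst c \<longrightarrow> v c = 0)}"

text \<open>The tangent vector at \<open>p\<close> whose coordinate vector in the chart \<open>c\<close> is \<open>u\<close>.\<close>

definition coord_vector ::
  "('a, 'e::euclidean_space) chart set \<Rightarrow> ('a, 'e) chart \<Rightarrow> 'a \<Rightarrow> 'e \<Rightarrow> (('a, 'e) chart \<Rightarrow> 'e)" where
  "coord_vector M c p u = (\<lambda>d. if d \<in> M \<and> p \<in> fst d
     then frechet_derivative (snd d \<circ> chart_inv c) (at (snd c p)) u else 0)"

definition chart_at :: "('a, 'e) chart set \<Rightarrow> 'a \<Rightarrow> ('a, 'e) chart" where
  "chart_at M p = (SOME c. c \<in> M \<and> p \<in> fst c)"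

text \<open>By the chain rule, the differentials do not depend on the chart chosen around \<open>p\<close>.\<close>

definition tangent_map ::
  "('a, 'e::euclidean_space) chart set \<Rightarrow> ('b, 'f::euclidean_space) chart set \<Rightarrow> ('a \<Rightarrow> 'b) \<Rightarrow>
   'a \<Rightarrow> (('a, 'e) chart \<Rightarrow> 'e) \<Rightarrow> (('b, 'f) chart \<Rightarrow> 'f)" where
  "tangent_map M N f p v = (let c = chart_at M p in (\<lambda>d. if d \<in> N \<and> f p \<in> fst d
     then frechet_derivative (snd d \<circ> f \<circ> chart_inv c) (at (snd c p)) (v c) else 0))"

definition differential ::
  "('a, 'e::euclidean_space) chart set \<Rightarrow> ('a \<Rightarrow> real) \<Rightarrow> 'a \<Rightarrow> (('a, 'e) chart \<Rightarrow> 'e) \<Rightarrow> real" where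
  "differential M f p v = (let c = chart_at M p in
     frechet_derivative (f \<circ> chart_inv c) (at (snd c p)) (v c))"

definition vector_fields ::
  "('a, 'e::euclidean_space) chart set \<Rightarrow> ('a \<Rightarrow> (('a, 'e) chart \<Rightarrow> 'e)) set" where
  "vector_fields M = {X. (\<forall>p. X p \<in> tangent_space M p) \<and>
     (\<forall>c\<in>M. smooth_on (chart_image c) (\<lambda>x. X (chart_inv c x) c))}"

type_synonym ('a, 'e) form2 =
  "'a \<Rightarrow> (('a, 'e) chart \<Rightarrow> 'e) \<Rightarrow> (('a, 'e) chart \<Rightarrow> 'e) \<Rightarrow> real"

definition form2_coord ::
  "('a, 'e::euclidean_space) chart set \<Rightarrow> ('a, 'e) form2 \<Rightarrow> ('a, 'e) chart \<Rightarrow>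
   'e \<Rightarrow> 'e \<Rightarrow> 'e \<Rightarrow> real" where
  "form2_coord M \<Omega> c x u v =
     \<Omega> (chart_inv c x) (coord_vector M c (chart_inv c x) u) (coord_vector M c (chart_inv c x) v)"

definition differential_form2 ::
  "('a, 'e::euclidean_space) chart set \<Rightarrow> ('a, 'e) form2 \<Rightarrow> bool" where
  "differential_form2 M \<Omega> \<longleftrightarrow>
     (\<forall>p. \<forall>v\<in>tangent_space M p. \<forall>v'\<in>tangent_space M p. \<forall>w\<in>tangent_space M p. \<forall>r.
        \<Omega> p (\<lambda>c. v c + v' c) w = \<Omega> p v w + \<Omega> p v' w \<and>
        \<Omega> p (\<lambda>c. r *\<^sub>R v c) w = r * \<Omega> p v w \<and>
        \<Omega> p v w = - \<Omega> p w v) \<and>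
     (\<forall>c\<in>M. \<forall>u v. smooth_on (chart_image c) (\<lambda>x. form2_coord M \<Omega> c x u v))"

text \<open>
  The coordinate expression of \<open>d\<Omega>\<close> in the chart \<open>c\<close>, at the point with coordinates \<open>x\<close>,
  evaluated on the vectors with coordinates \<open>u, v, w\<close>: for the commuting coordinate fields
  \<open>u, v, w\<close> one has \<open>d\<Omega>(u,v,w) = u(\<Omega>(v,w)) + v(\<Omega>(w,u)) + w(\<Omega>(u,v))\<close>.
\<close>

definition ext_deriv_coord ::
  "('a, 'e::euclidean_space) chart set \<Rightarrow> ('a, 'e) form2 \<Rightarrow> ('a, 'e) chart \<Rightarrow>
   'e \<Rightarrow> 'e \<Rightarrow> 'e \<Rightarrow> 'e \<Rightarrow> real" where
  "ext_deriv_coord M \<Omega> c x u v w =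
     frechet_derivative (\<lambda>y. form2_coord M \<Omega> c y v w) (at x) u +
     frechet_derivative (\<lambda>y. form2_coord M \<Omega> c y w u) (at x) v +
     frechet_derivative (\<lambda>y. form2_coord M \<Omega> c y u v) (at x) w"

definition symplectic_form ::
  "('a, 'e::euclidean_space) chart set \<Rightarrow> ('a, 'e) form2 \<Rightarrow> bool" where
  "symplectic_form M \<Omega> \<longleftrightarrow> differential_form2 M \<Omega> \<and>
     (\<forall>c\<in>M. \<forall>x\<in>chart_image c. \<forall>u v w. ext_deriv_coord M \<Omega> c x u v w = 0) \<and>
     (\<forall>p. \<forall>v\<in>tangent_space M p. (\<forall>w\<in>tangent_space M p. \<Omega> p v w = 0) \<longrightarrow> v = (\<lambda>c. 0))"

definition pullback_form2 ::
  "('a, 'e::euclidean_space) chart set \<Rightarrow> ('b, 'f::euclidean_space) chart set \<Rightarrow> ('a \<Rightarrow> 'b) \<Rightarrow>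
   ('b, 'f) form2 \<Rightarrow> ('a, 'e) form2" where
  "pullback_form2 M N f \<Omega> p v w = \<Omega> (f p) (tangent_map M N f p v) (tangent_map M N f p w)"


section \<open>Hamiltonian vector fields and Poisson structures\<close>

definition hamiltonian_vector_field ::
  "('a, 'e::euclidean_space) chart set \<Rightarrow> ('a, 'e) form2 \<Rightarrow> ('a \<Rightarrow> real) \<Rightarrow>
   ('a \<Rightarrow> (('a, 'e) chart \<Rightarrow> 'e))" where
  "hamiltonian_vector_field M \<Omega> F = (THE X. X \<in> vector_fields M \<and>
     (\<forall>p. \<forall>w\<in>tangent_space M p. \<Omega> p (X p) w = differential M F p w))"

definition symplectic_bracket ::
  "('a, 'e::euclidean_space) chart set \<Rightarrow> ('a, 'e) form2 \<Rightarrow>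
   ('a \<Rightarrow> real) \<Rightarrow> ('a \<Rightarrow> real) \<Rightarrow> ('a \<Rightarrow> real)" where
  "symplectic_bracket M \<Omega> F F' =
     (\<lambda>p. \<Omega> p (hamiltonian_vector_field M \<Omega> F p) (hamiltonian_vector_field M \<Omega> F' p))"

text \<open>
  The bracket is an operation on smooth functions; the extensional function space fixes its
  irrelevant values at other arguments, so that uniqueness can be expressed by equality.
\<close>

definition poisson_structure ::
  "('a::topological_space, 'e::euclidean_space) chart set \<Rightarrow>
   (('a \<Rightarrow> real) \<Rightarrow> ('a \<Rightarrow> real) \<Rightarrow> ('a \<Rightarrow> real)) \<Rightarrow> bool" where
  "poisson_structure M B \<longleftrightarrow>
     B \<in> smooth_functions M \<rightarrow>\<^sub>E (smooth_functions M \<rightarrow>\<^sub>E smooth_functions M) \<and>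
     (\<forall>f\<in>smooth_functions M. \<forall>g\<in>smooth_functions M. \<forall>h\<in>smooth_functions M. \<forall>r.
        B (\<lambda>x. f x + g x) h = (\<lambda>x. B f h x + B g h x) \<and>
        B (\<lambda>x. r * f x) h = (\<lambda>x. r * B f h x) \<and>
        B f g = (\<lambda>x. - B g f x) \<and>
        (\<forall>x. B f (B g h) x + B g (B h f) x + B h (B f g) x = 0) \<and>
        B f (\<lambda>x. g x * h x) = (\<lambda>x. B f g x * h x + g x * B f h x))"


section \<open>Symplectic principal bundles with structure group the additive reals\<close>

definition principal_R_bundle ::
  "('a::{t2_space,second_countable_topology}, 'e::euclidean_space) chart set \<Rightarrow>
   ('v::{t2_space,second_countable_topology}, 'f::euclidean_space) chart set \<Rightarrow>
   ('a \<Rightarrow> 'v) \<Rightarrow> (real \<Rightarrow> 'a \<Rightarrow> 'a) \<Rightarrow> bool" where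
  "principal_R_bundle A V \<mu> \<psi> \<longleftrightarrow>
     smooth_manifold A \<and> smooth_manifold V \<and>
     smooth_map_on A V UNIV \<mu> \<and>
     smooth_map_on (prod_atlas real_atlas A) A UNIV (\<lambda>(s, a). \<psi> s a) \<and>
     (\<forall>a. \<psi> 0 a = a) \<and> (\<forall>s t a. \<psi> (s + t) a = \<psi> s (\<psi> t a)) \<and>
     (\<forall>s a. \<mu> (\<psi> s a) = \<mu> a) \<and>
     (\<forall>y. \<exists>U \<Phi>. open U \<and> y \<in> U \<and>
        diffeomorphism_on A (prod_atlas V real_atlas) (\<mu> -` U) (U \<times> UNIV) \<Phi> \<and>
        (\<forall>a\<in>\<mu> -` U. fst (\<Phi> a) = \<mu> a \<and> (\<forall>s. snd (\<Phi> (\<psi> s a)) = s + snd (\<Phi> a))))"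

definition symplectic_principal_R_bundle ::
  "('a::{t2_space,second_countable_topology}, 'e::euclidean_space) chart set \<Rightarrow> ('a, 'e) form2 \<Rightarrow>
   ('v::{t2_space,second_countable_topology}, 'f::euclidean_space) chart set \<Rightarrow>
   ('a \<Rightarrow> 'v) \<Rightarrow> (real \<Rightarrow> 'a \<Rightarrow> 'a) \<Rightarrow> bool" where
  "symplectic_principal_R_bundle A \<Omega> V \<mu> \<psi> \<longleftrightarrow>
     principal_R_bundle A V \<mu> \<psi> \<and> symplectic_form A \<Omega> \<and>
     (\<forall>s p. \<forall>v\<in>tangent_space A p. \<forall>w\<in>tangent_space A p.
        pullback_form2 A A (\<psi> s) \<Omega> p v w = \<Omega> p v w)"

end

theory Submission
  imports Defs
begin

text \<open>
  The functions on \<open>V\<close> are, by pullback along \<open>\<mu>\<close>, the functions on \<open>A\<close> that are invariant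
  under the action: two points of a fibre lie on one orbit (\<open>fibre_eq_orbit\<close>), and an invariant
  smooth function descends to a smooth function because \<open>\<mu>\<close> has smooth local sections
  (\<open>invariant_function_descends\<close>). It therefore suffices that the smooth functions on \<open>A\<close> form a
  Poisson algebra in which the invariant functions are closed under the bracket. The identities of a
  Poisson structure then pass to \<open>V\<close> because \<open>\<mu>\<close> is surjective, and surjectivity also gives the
  uniqueness.

  Invariance holds because every \<open>\<psi> s\<close> is a symplectic map. Its tangent maps preserve a
  nondegenerate form, so they are injective and, by equality of dimensions, surjective
  (\<open>symplectic_map_tangent_map_surj\<close>); nondegeneracy then shows that the Hamiltonian vector field of
  an invariant function is carried to itself, and the bracket is the value of the form on two such
  fields.

  For the Poisson algebra on \<open>A\<close> the main points are the following. The Hamiltonian vector field in a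
  chart solves a linear system whose invertible matrix and right-hand side are smooth, hence is smooth
  (\<open>smooth_on_linear_solution\<close>). The bracket is \<open>{F, G} = dF (X\<^sub>G)\<close>, so it is smooth and a derivation
  in \<open>F\<close>. The Jacobi identity is local; in a chart it follows from the closedness of the form and
  from the symmetry of second derivatives (\<open>jacobi_in_coordinates\<close>).

  The coordinate arguments rest on a calculus of the predicates \<open>Ck_on\<close> and \<open>smooth_on\<close>: products,
  compositions, local character and Schwarz's theorem.
\<close>

section \<open>Calculus of smooth maps on open sets\<close>

lemma has_frechet_derivative:
  "f differentiable (at x) \<Longrightarrow> (f has_derivative frechet_derivative f (at x)) (at x)"
  using frechet_derivative_works by blast

lemma frechet_derivative_eqI:
  "(f has_derivative f') (at x) \<Longrightarrow> frechet_derivative f (at x) = f'"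
  using frechet_derivative_at by metis

lemma linear_eq_sum_Basis:
  fixes L :: "'e::euclidean_space \<Rightarrow> 'f::real_vector"
  assumes "linear L"
  shows "L u = (\<Sum>i\<in>Basis. (u \<bullet> i) *\<^sub>R L i)"
proof -
  have "L u = L (\<Sum>i\<in>Basis. (u \<bullet> i) *\<^sub>R i)" by (simp add: euclidean_representation)
  also have "\<dots> = (\<Sum>i\<in>Basis. (u \<bullet> i) *\<^sub>R L i)"
    by (simp add: linear_sum[OF assms] linear_cmul[OF assms])
  finally show ?thesis .
qed

lemma Ck_on_cong:
  assumes "open S" "\<And>x. x \<in> S \<Longrightarrow> f x = g x" "Ck_on k S f"
  shows "Ck_on k S g"
  using assms(2,3)
proof (induction k arbitrary: f g)
  case 0
  then show ?case by (auto cong: continuous_on_cong)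
next
  case (Suc k)
  have d: "(g has_derivative frechet_derivative f (at x)) (at x)" if "x \<in> S" for x
    using Suc.prems that assms(1)
    by (intro has_derivative_transform_within_open[OF has_frechet_derivative]) auto
  have "Ck_on k S (\<lambda>x. frechet_derivative g (at x) v)" for v
  proof (rule Suc.IH)
    show "frechet_derivative f (at x) v = frechet_derivative g (at x) v" if "x \<in> S" for x
      using frechet_derivative_eqI[OF d[OF that]] by simp
  qed (use Suc.prems in auto)
  then show ?case using d unfolding Ck_on.simps differentiable_def by blast
qed

text \<open>It suffices to know some family of derivatives, not \<open>frechet_derivative\<close> itself.\<close>

lemma Ck_on_SucI:
  assumes "open S" "\<And>x. x \<in> S \<Longrightarrow> (f has_derivative f' x) (at x)"
    "\<And>v. Ck_on k S (\<lambda>x. f' x v)"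
  shows "Ck_on (Suc k) S f"
proof -
  have "Ck_on k S (\<lambda>x. frechet_derivative f (at x) v)" for v
    by (rule Ck_on_cong[OF assms(1) _ assms(3)[of v]])
      (simp add: frechet_derivative_eqI[OF assms(2)])
  then show ?thesis using assms(2) unfolding Ck_on.simps differentiable_def by blast
qed

lemma Ck_on_has_derivative:
  "Ck_on (Suc k) S f \<Longrightarrow> x \<in> S \<Longrightarrow> (f has_derivative frechet_derivative f (at x)) (at x)"
  by (auto intro: has_frechet_derivative)

lemma Ck_on_subset: "Ck_on k S f \<Longrightarrow> T \<subseteq> S \<Longrightarrow> Ck_on k T f"
  by (induction k arbitrary: f) (auto intro: continuous_on_subset)

lemma Ck_on_Suc_imp: "Ck_on (Suc k) S f \<Longrightarrow> Ck_on k S f"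
proof (induction k arbitrary: f)
  case 0
  then show ?case
    by (auto intro!: continuous_at_imp_continuous_on differentiable_imp_continuous_within)
next
  case (Suc k)
  then show ?case by auto
qed

lemma Ck_on_local:
  assumes "\<And>x. x \<in> S \<Longrightarrow> \<exists>T. open T \<and> x \<in> T \<and> Ck_on k T f"
  shows "Ck_on k S f"
  using assms
proof (induction k arbitrary: f)
  case 0
  then show ?case
    by (metis Ck_on.simps(1) continuous_at_imp_continuous_on continuous_on_eq_continuous_at)
next
  case (Suc k)
  show ?case unfolding Ck_on.simps
  proof (intro conjI ballI allI)
    show "f differentiable at x" if "x \<in> S" for x
      using Suc.prems[OF that] by auto
    show "Ck_on k S (\<lambda>x. frechet_derivative f (at x) v)" for v
      by (rule Suc.IH) (use Suc.prems in fastforce)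
  qed
qed

lemma Ck_on_const: "Ck_on k S (\<lambda>x. c)"
proof (induction k arbitrary: c)
  case (Suc k)
  then show ?case by simp
qed simp

lemma Ck_on_bounded_linear:
  assumes "bounded_linear h" "open S" "Ck_on k S f"
  shows "Ck_on k S (\<lambda>x. h (f x))"
  using assms(3)
proof (induction k arbitrary: f)
  case 0
  then show ?case using bounded_linear.continuous_on[OF assms(1)] by auto
next
  case (Suc k)
  show ?case
  proof (rule Ck_on_SucI[OF assms(2)])
    show "((\<lambda>x. h (f x)) has_derivative (\<lambda>v. h (frechet_derivative f (at x) v))) (at x)"
      if "x \<in> S" for x
      by (rule bounded_linear.has_derivative[OF assms(1) Ck_on_has_derivative[OF Suc.prems that]])
  qed (use Suc in auto)
qed

lemma Ck_on_add:
  assumes "open S" "Ck_on k S f" "Ck_on k S g"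
  shows "Ck_on k S (\<lambda>x. f x + g x)"
  using assms(2,3)
proof (induction k arbitrary: f g)
  case 0
  then show ?case by (auto intro: continuous_intros)
next
  case (Suc k)
  show ?case
  proof (rule Ck_on_SucI[OF assms(1)])
    show "((\<lambda>x. f x + g x) has_derivative
      (\<lambda>v. frechet_derivative f (at x) v + frechet_derivative g (at x) v)) (at x)"
      if "x \<in> S" for x
      by (intro has_derivative_add Ck_on_has_derivative[OF Suc.prems(1) that]
          Ck_on_has_derivative[OF Suc.prems(2) that])
  qed (use Suc in auto)
qed

lemma Ck_on_bounded_bilinear:
  assumes "bounded_bilinear b" "open S" "Ck_on k S f" "Ck_on k S g"
  shows "Ck_on k S (\<lambda>x. b (f x) (g x))"
  using assms(3,4)
proof (induction k arbitrary: f g)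
  case 0
  then show ?case using bounded_bilinear.continuous_on[OF assms(1)] by auto
next
  case (Suc k)
  show ?case
  proof (rule Ck_on_SucI[OF assms(2)])
    show "((\<lambda>x. b (f x) (g x)) has_derivative
      (\<lambda>v. b (f x) (frechet_derivative g (at x) v) + b (frechet_derivative f (at x) v) (g x))) (at x)"
      if "x \<in> S" for x
      by (rule bounded_bilinear.FDERIV[OF assms(1) Ck_on_has_derivative[OF Suc.prems(1) that]
          Ck_on_has_derivative[OF Suc.prems(2) that]])
    show "Ck_on k S (\<lambda>x. b (f x) (frechet_derivative g (at x) v) +
        b (frechet_derivative f (at x) v) (g x))" for v
      using Suc.prems Ck_on_Suc_imp[OF Suc.prems(1)] Ck_on_Suc_imp[OF Suc.prems(2)]
      by (intro Ck_on_add[OF assms(2)] Suc.IH) auto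
  qed
qed

lemma Ck_on_sum:
  assumes "open S" "\<And>i. i \<in> I \<Longrightarrow> Ck_on k S (f i)"
  shows "Ck_on k S (\<lambda>x. \<Sum>i\<in>I. f i x)"
  using assms(2)
  by (induction I rule: infinite_finite_induct) (auto intro: Ck_on_add[OF assms(1)] Ck_on_const)

text \<open>
  The family \<open>L\<close> of linear maps is only assumed to be of class \<open>C\<^sup>k\<close> pointwise; this is enough since
  the maps are determined by their values on the standard basis.
\<close>

lemma Ck_on_linear_apply:
  fixes L :: "'e::euclidean_space \<Rightarrow> 'f::euclidean_space \<Rightarrow> 'g::euclidean_space"
  assumes "open S" "\<And>x. x \<in> S \<Longrightarrow> linear (L x)" "\<And>u. Ck_on k S (\<lambda>x. L x u)" "Ck_on k S Y"
  shows "Ck_on k S (\<lambda>x. L x (Y x))"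
proof -
  have "Ck_on k S (\<lambda>x. \<Sum>i\<in>Basis. (Y x \<bullet> i) *\<^sub>R L x i)"
  proof (rule Ck_on_sum[OF assms(1)])
    show "Ck_on k S (\<lambda>x. (Y x \<bullet> i) *\<^sub>R L x i)" for i
      by (rule Ck_on_bounded_bilinear[OF bounded_bilinear_scaleR assms(1)
            Ck_on_bounded_linear[OF bounded_linear_inner_left assms(1) assms(4)] assms(3)])
  qed
  then show ?thesis
    by (rule Ck_on_cong[OF assms(1), rotated]) (metis assms(2) linear_eq_sum_Basis)
qed

lemma Ck_on_compose:
  fixes f :: "'e::euclidean_space \<Rightarrow> 'f::euclidean_space" and g :: "'f \<Rightarrow> 'g::euclidean_space"
  assumes "open S" "open T" "Ck_on k S f" "Ck_on k T g" "f ` S \<subseteq> T"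
  shows "Ck_on k S (\<lambda>x. g (f x))"
  using assms(3,4)
proof (induction k arbitrary: g)
  case 0
  then show ?case using assms(5) by (auto intro: continuous_on_compose2)
next
  case (Suc k)
  have f: "Ck_on k S f" using Suc.prems Ck_on_Suc_imp by blast
  have d: "(g has_derivative frechet_derivative g (at (f x))) (at (f x))" if "x \<in> S" for x
    using that assms(5) Ck_on_has_derivative[OF Suc.prems(2)] by blast
  show ?case
  proof (rule Ck_on_SucI[OF assms(1)])
    show "((\<lambda>x. g (f x)) has_derivative
      (\<lambda>v. frechet_derivative g (at (f x)) (frechet_derivative f (at x) v))) (at x)"
      if "x \<in> S" for x
      by (rule has_derivative_compose[OF Ck_on_has_derivative[OF Suc.prems(1) that] d[OF that]])
    show "Ck_on k S (\<lambda>x. frechet_derivative g (at (f x)) (frechet_derivative f (at x) v))" for v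
    proof (rule Ck_on_linear_apply[OF assms(1), where L = "\<lambda>x. frechet_derivative g (at (f x))"
          and Y = "\<lambda>x. frechet_derivative f (at x) v"])
      show "linear (frechet_derivative g (at (f x)))" if "x \<in> S" for x
        using d[OF that] has_derivative_linear by blast
      show "Ck_on k S (\<lambda>x. frechet_derivative g (at (f x)) u)" for u
        by (rule Suc.IH[of "\<lambda>y. frechet_derivative g (at y) u"]) (use f Suc.prems in auto)
    qed (use Suc.prems in auto)
  qed
qed

lemma smooth_on_cong:
  "open S \<Longrightarrow> (\<And>x. x \<in> S \<Longrightarrow> f x = g x) \<Longrightarrow> smooth_on S f \<Longrightarrow> smooth_on S g"
  unfolding smooth_on_def using Ck_on_cong by blast

lemma smooth_on_subset: "smooth_on S f \<Longrightarrow> T \<subseteq> S \<Longrightarrow> smooth_on T f"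
  unfolding smooth_on_def using Ck_on_subset by blast

lemma smooth_on_local:
  assumes "\<And>x. x \<in> S \<Longrightarrow> \<exists>T. open T \<and> x \<in> T \<and> smooth_on T f"
  shows "smooth_on S f"
  unfolding smooth_on_def using assms Ck_on_local unfolding smooth_on_def by metis

lemma smooth_on_const: "smooth_on S (\<lambda>x. c)"
  unfolding smooth_on_def using Ck_on_const by blast

lemma smooth_on_has_derivative:
  "smooth_on S f \<Longrightarrow> x \<in> S \<Longrightarrow> (f has_derivative frechet_derivative f (at x)) (at x)"
  unfolding smooth_on_def using Ck_on_has_derivative by blast

lemma smooth_on_differentiable: "smooth_on S f \<Longrightarrow> x \<in> S \<Longrightarrow> f differentiable (at x)"
  using smooth_on_has_derivative differentiable_def by blast

lemma smooth_on_frechet_derivative: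
  "smooth_on S f \<Longrightarrow> smooth_on S (\<lambda>x. frechet_derivative f (at x) v)"
  unfolding smooth_on_def using Ck_on.simps(2) by blast

lemma smooth_on_continuous: "smooth_on S f \<Longrightarrow> continuous_on S f"
  unfolding smooth_on_def using Ck_on.simps(1) by blast

lemma smooth_on_bounded_linear:
  "bounded_linear h \<Longrightarrow> open S \<Longrightarrow> smooth_on S f \<Longrightarrow> smooth_on S (\<lambda>x. h (f x))"
  unfolding smooth_on_def by (intro allI Ck_on_bounded_linear[where h = h]) auto

lemma smooth_on_add:
  "open S \<Longrightarrow> smooth_on S f \<Longrightarrow> smooth_on S g \<Longrightarrow> smooth_on S (\<lambda>x. f x + g x)"
  unfolding smooth_on_def by (intro allI Ck_on_add) auto

lemma smooth_on_bounded_bilinear: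
  "bounded_bilinear b \<Longrightarrow> open S \<Longrightarrow> smooth_on S f \<Longrightarrow> smooth_on S g
    \<Longrightarrow> smooth_on S (\<lambda>x. b (f x) (g x))"
  unfolding smooth_on_def by (intro allI Ck_on_bounded_bilinear[where b = b]) auto

lemma smooth_on_sum:
  "open S \<Longrightarrow> (\<And>i. i \<in> I \<Longrightarrow> smooth_on S (f i)) \<Longrightarrow> smooth_on S (\<lambda>x. \<Sum>i\<in>I. f i x)"
  unfolding smooth_on_def by (intro allI Ck_on_sum) auto

lemma smooth_on_linear_apply:
  "open S \<Longrightarrow> (\<And>x. x \<in> S \<Longrightarrow> linear (L x)) \<Longrightarrow> (\<And>u. smooth_on S (\<lambda>x. L x u)) \<Longrightarrow> smooth_on S Y
    \<Longrightarrow> smooth_on S (\<lambda>x. L x (Y x))"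
  unfolding smooth_on_def by (intro allI Ck_on_linear_apply[where L = L and Y = Y]) auto

lemma smooth_on_compose:
  "open S \<Longrightarrow> open T \<Longrightarrow> smooth_on S f \<Longrightarrow> smooth_on T g \<Longrightarrow> f ` S \<subseteq> T
    \<Longrightarrow> smooth_on S (\<lambda>x. g (f x))"
  unfolding smooth_on_def by (intro allI Ck_on_compose[where f = f and g = g]) auto

lemma smooth_on_Pair:
  assumes "open S" "smooth_on S f" "smooth_on S g"
  shows "smooth_on S (\<lambda>x. (f x, g x))"
proof -
  have "smooth_on S (\<lambda>x. (f x, 0) + (0, g x))"
    by (intro smooth_on_add assms smooth_on_bounded_linear[of "\<lambda>u. (u, 0)"]
        smooth_on_bounded_linear[of "\<lambda>u. (0, u)"]
        bounded_linear_Pair bounded_linear_ident bounded_linear_zero)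
  then show ?thesis by simp
qed

section \<open>Smooth solutions of smooth linear systems\<close>

text \<open>
  The product rule for \<open>L y (Y y)\<close>, where the family of linear maps \<open>L\<close> is only assumed
  differentiable pointwise.
\<close>

lemma has_derivative_linear_apply:
  fixes L :: "'e::euclidean_space \<Rightarrow> 'f::euclidean_space \<Rightarrow> 'g::euclidean_space"
  assumes S: "open S" "x \<in> S" and lin: "\<And>y. y \<in> S \<Longrightarrow> linear (L y)"
    and L': "\<And>u. ((\<lambda>y. L y u) has_derivative (\<lambda>h. L' h u)) (at x)"
    and Y': "(Y has_derivative Y') (at x)"
  shows "((\<lambda>y. L y (Y y)) has_derivative (\<lambda>h. L' h (Y x) + L x (Y' h))) (at x)"
proof -
  have linL': "linear (L' h)" for h
  proof (rule linearI)
    fix u v :: 'f and r :: real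
    have "((\<lambda>y. L y (u + v)) has_derivative (\<lambda>h. L' h u + L' h v)) (at x)"
      by (rule has_derivative_transform_within_open[OF has_derivative_add[OF L'[of u] L'[of v]] S])
        (simp add: linear_add[OF lin])
    from fun_cong[OF has_derivative_unique[OF this L'], of h]
    show "L' h (u + v) = L' h u + L' h v" by simp
    have "((\<lambda>y. L y (r *\<^sub>R u)) has_derivative (\<lambda>h. r *\<^sub>R L' h u)) (at x)"
      by (rule has_derivative_transform_within_open[OF has_derivative_scaleR_right[OF L'[of u]] S])
        (simp add: linear_cmul[OF lin])
    from fun_cong[OF has_derivative_unique[OF this L'], of h]
    show "L' h (r *\<^sub>R u) = r *\<^sub>R L' h u" by simp
  qed
  have "((\<lambda>y. \<Sum>i\<in>Basis. (Y y \<bullet> i) *\<^sub>R L y i) has_derivative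
     (\<lambda>h. \<Sum>i\<in>Basis. (Y x \<bullet> i) *\<^sub>R L' h i + (Y' h \<bullet> i) *\<^sub>R L x i)) (at x)"
    by (intro has_derivative_sum has_derivative_scaleR L'
        bounded_linear.has_derivative[OF bounded_linear_inner_left] Y')
  moreover have "(\<Sum>i\<in>Basis. (Y x \<bullet> i) *\<^sub>R L' h i + (Y' h \<bullet> i) *\<^sub>R L x i) = L' h (Y x) + L x (Y' h)" for h
    by (simp add: sum.distrib linear_eq_sum_Basis[OF linL', of h "Y x"]
        linear_eq_sum_Basis[OF lin[OF S(2)], of "Y' h"])
  ultimately have "((\<lambda>y. \<Sum>i\<in>Basis. (Y y \<bullet> i) *\<^sub>R L y i) has_derivative
     (\<lambda>h. L' h (Y x) + L x (Y' h))) (at x)" by simp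
  then show ?thesis
    by (rule has_derivative_transform_within_open[OF _ S]) (metis lin linear_eq_sum_Basis)
qed

text \<open>
  When both factors vanish at \<open>x\<close>, differentiability of one and continuity of the other suffice for
  the product to be differentiable.
\<close>

lemma has_derivative_scaleR_zero:
  fixes f :: "'e::real_normed_vector \<Rightarrow> real" and h :: "'e \<Rightarrow> 'f::real_normed_vector"
  assumes f: "f \<midarrow>x\<rightarrow> 0" "f x = 0" and h: "(h has_derivative h') (at x)" "h x = 0"
  shows "((\<lambda>y. f y *\<^sub>R h y) has_derivative (\<lambda>v. 0)) (at x)"
  unfolding has_derivative_at_alt
proof (intro conjI allI impI bounded_linear_zero)
  fix e :: real assume e: "0 < e"
  have bl: "bounded_linear h'" using h(1) has_derivative_bounded_linear by blast
  obtain B where B: "B > 0" "\<And>v. norm (h' v) \<le> norm v * B"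
    using bounded_linear.pos_bounded[OF bl] by blast
  obtain d1 where d1: "d1 > 0" "\<And>y. norm (y - x) < d1 \<Longrightarrow> norm (h y - h x - h' (y - x)) \<le> 1 * norm (y - x)"
    using h(1)[unfolded has_derivative_at_alt] zero_less_one by blast
  have e': "0 < e / (B + 1)" using e B by simp
  obtain d2 where d2: "d2 > 0" "\<And>y. y \<noteq> x \<Longrightarrow> norm (y - x) < d2 \<Longrightarrow> norm (f y - 0) < e / (B + 1)"
    using LIM_D[OF f(1) e'] by blast
  show "\<exists>d>0. \<forall>y. norm (y - x) < d \<longrightarrow>
      norm (f y *\<^sub>R h y - f x *\<^sub>R h x - 0) \<le> e * norm (y - x)"
  proof (intro exI[of _ "min d1 d2"] conjI allI impI)
    show "min d1 d2 > 0" using d1 d2 by simp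
    fix y assume y: "norm (y - x) < min d1 d2"
    have "norm (h y) \<le> norm (h y - h x - h' (y - x)) + norm (h' (y - x))"
      using norm_triangle_ineq[of "h y - h x - h' (y - x)" "h' (y - x)"] h(2) by simp
    also have "\<dots> \<le> (B + 1) * norm (y - x)"
      using d1(2)[of y] B(2)[of "y - x"] y by (simp add: algebra_simps)
    finally have 1: "norm (h y) \<le> (B + 1) * norm (y - x)" .
    have 2: "\<bar>f y\<bar> \<le> e / (B + 1)"
      using d2(2)[of y] y f(2) e' by (cases "y = x") auto
    have "norm (f y *\<^sub>R h y) \<le> (e / (B + 1)) * ((B + 1) * norm (y - x))"
      unfolding norm_scaleR using 1 2 e' by (intro mult_mono) auto
    also have "\<dots> = e * norm (y - x)" using B(1) by simp
    finally show "norm (f y *\<^sub>R h y - f x *\<^sub>R h x - 0) \<le> e * norm (y - x)"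
      using f(2) by simp
  qed
qed

text \<open>
  A solution \<open>Y\<close> of \<open>L y (Y y) = b y\<close> satisfies, with \<open>M\<close> the inverse of \<open>L x\<close>, the identity
  \<open>Y y - Y x = M (b y - L y (Y x)) - (M \<circ> L y - id) (Y y - Y x)\<close>,
  whose last term is absorbed by the left-hand side when \<open>y\<close> is close to \<open>x\<close>.
\<close>

lemma linear_system_identity:
  fixes L :: "'d \<Rightarrow> 'e::euclidean_space \<Rightarrow> 'e"
  assumes "linear M" "linear (L y)" "L y (Y y) = b y"
  shows "Y y = Y x + M (b y - L y (Y x))
    - (\<Sum>i\<in>Basis. ((Y y - Y x) \<bullet> i) *\<^sub>R (M (L y i) - i))"
proof -
  have "linear (\<lambda>u. M (L y u) - u)"
    using linear_compose_sub[OF linear_compose[OF assms(2,1)] linear_id] by (simp add: o_def id_def)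
  from linear_eq_sum_Basis[OF this, of "Y y - Y x"]
  have "(\<Sum>i\<in>Basis. ((Y y - Y x) \<bullet> i) *\<^sub>R (M (L y i) - i)) = M (L y (Y y - Y x)) - (Y y - Y x)"
    by simp
  then show ?thesis
    by (simp add: linear_diff[OF assms(1)] linear_diff[OF assms(2)] assms(3))
qed

lemma tendsto_linear_solution:
  fixes L :: "'d::t2_space \<Rightarrow> 'e::euclidean_space \<Rightarrow> 'e"
  assumes S: "open S" "x \<in> S" and lin: "\<And>y. y \<in> S \<Longrightarrow> linear (L y)" and inj: "inj (L x)"
    and L: "\<And>u. ((\<lambda>y. L y u) \<longlongrightarrow> L x u) (at x)" and b: "(b \<longlongrightarrow> b x) (at x)"
    and Y: "\<And>y. y \<in> S \<Longrightarrow> L y (Y y) = b y"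
  shows "(Y \<longlongrightarrow> Y x) (at x)"
proof -
  obtain M where M: "linear M" "M \<circ> L x = id"
    using linear_injective_left_inverse[OF lin[OF S(2)] inj] by blast
  have Mx: "M (L x u) = u" for u using M(2) by (metis comp_apply id_apply)
  have Mt: "((\<lambda>y. M (h y)) \<longlongrightarrow> M l) F" if "(h \<longlongrightarrow> l) F" for h l and F :: "'d filter"
    using bounded_linear.tendsto[OF _ that] M(1) linear_conv_bounded_linear by blast
  define e where "e y = (\<Sum>i\<in>Basis. norm (M (L y i) - i))" for y
  define g where "g y = M (b y - L y (Y x))" for y
  have "(e \<longlongrightarrow> (\<Sum>i\<in>(Basis::'e set). norm (M (L x i) - i))) (at x)"
    unfolding e_def by (intro tendsto_sum tendsto_norm tendsto_diff Mt L tendsto_const)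
  then have e: "(e \<longlongrightarrow> 0) (at x)" by (simp add: Mx)
  have "(g \<longlongrightarrow> M (b x - L x (Y x))) (at x)"
    unfolding g_def by (intro tendsto_diff Mt L b)
  then have g: "(g \<longlongrightarrow> 0) (at x)" using Y[OF S(2)] M(1) by (simp add: linear_0)
  have "\<forall>\<^sub>F y in at x. e y < 1/2" by (rule order_tendstoD(2)[OF e]) simp
  moreover have "\<forall>\<^sub>F y in at x. y \<in> S" by (rule eventually_at_in_open'[OF S])
  ultimately have "\<forall>\<^sub>F y in at x. norm (Y y - Y x) \<le> 2 * norm (g y)"
  proof eventually_elim
    case (elim y)
    let ?D = "Y y - Y x"
    have "norm (\<Sum>i\<in>Basis. (?D \<bullet> i) *\<^sub>R (M (L y i) - i)) \<le> (\<Sum>i\<in>Basis. norm ?D * norm (M (L y i) - i))"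
      by (rule sum_norm_le) (auto intro!: mult_right_mono Basis_le_norm)
    also have "\<dots> = norm ?D * e y" by (simp add: e_def sum_distrib_left)
    also have "\<dots> \<le> norm ?D * (1/2)" using elim by (intro mult_left_mono) auto
    finally have s: "norm (\<Sum>i\<in>Basis. (?D \<bullet> i) *\<^sub>R (M (L y i) - i)) \<le> norm ?D * (1/2)" .
    have "?D = g y - (\<Sum>i\<in>Basis. (?D \<bullet> i) *\<^sub>R (M (L y i) - i))"
      using linear_system_identity[of M L y Y b x, OF M(1) lin Y] elim by (simp add: g_def algebra_simps)
    then have "norm ?D \<le> norm (g y) + norm (\<Sum>i\<in>Basis. (?D \<bullet> i) *\<^sub>R (M (L y i) - i))"
      by (metis norm_triangle_ineq4)
    with s show ?case by simp
  qed
  then have "((\<lambda>y. Y y - Y x) \<longlongrightarrow> 0) (at x)"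
    by (rule Lim_null_comparison)
      (use tendsto_mult_left[OF tendsto_norm[OF g], of 2] in simp)
  then show ?thesis using LIM_zero_iff by blast
qed

lemma differentiable_linear_solution:
  fixes L :: "'d::euclidean_space \<Rightarrow> 'e::euclidean_space \<Rightarrow> 'e"
  assumes S: "open S" "x \<in> S" and lin: "\<And>y. y \<in> S \<Longrightarrow> linear (L y)" and inj: "inj (L x)"
    and L: "\<And>u. (\<lambda>y. L y u) differentiable (at x)" and b: "b differentiable (at x)"
    and Y: "\<And>y. y \<in> S \<Longrightarrow> L y (Y y) = b y"
  shows "Y differentiable (at x)"
proof -
  obtain M where M: "linear M" "M \<circ> L x = id"
    using linear_injective_left_inverse[OF lin[OF S(2)] inj] by blast
  have Mx: "M (L x u) = u" for u using M(2) by (metis comp_apply id_apply)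
  have Md: "(\<lambda>y. M (h y)) differentiable (at x)" if "h differentiable (at x)" for h :: "'d \<Rightarrow> 'e"
    using bounded_linear.has_derivative[OF _ has_frechet_derivative[OF that]] M(1)
      linear_conv_bounded_linear differentiable_def by blast
  have t: "(h \<longlongrightarrow> h x) (at x)" if "h differentiable (at x)" for h :: "'d \<Rightarrow> 'e"
    using differentiable_imp_continuous_within[OF that] by (simp add: continuous_at)
  have Yt: "(Y \<longlongrightarrow> Y x) (at x)"
  proof (rule tendsto_linear_solution[where L = L, OF S lin inj _ t[OF b] Y])
    show "((\<lambda>y. L y u) \<longlongrightarrow> L x u) (at x)" for u
      using differentiable_imp_continuous_within[OF L] by (simp add: continuous_at)
  qed
  have p: "(\<lambda>y. ((Y y - Y x) \<bullet> i) *\<^sub>R (M (L y i) - i)) differentiable (at x)" for i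
  proof -
    have "((\<lambda>y. (Y y - Y x) \<bullet> i) \<longlongrightarrow> 0 \<bullet> i) (at x)"
      using Yt by (intro tendsto_intros) (simp add: LIM_zero_iff)
    then have f: "(\<lambda>y. (Y y - Y x) \<bullet> i) \<midarrow>x\<rightarrow> 0" by simp
    have "(\<lambda>y. M (L y i) - i) differentiable (at x)"
      by (intro differentiable_diff Md L) simp
    from has_derivative_scaleR_zero[OF f _ has_frechet_derivative[OF this]]
    have "((\<lambda>y. ((Y y - Y x) \<bullet> i) *\<^sub>R (M (L y i) - i)) has_derivative (\<lambda>v. 0)) (at x)"
      by (simp add: Mx)
    then show ?thesis unfolding differentiable_def by blast
  qed
  have "(\<lambda>y. Y x + M (b y - L y (Y x)) - (\<Sum>i\<in>Basis. ((Y y - Y x) \<bullet> i) *\<^sub>R (M (L y i) - i)))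
     differentiable (at x)"
    by (intro differentiable_diff differentiable_add differentiable_sum Md L b p ballI) auto
  moreover have "Y x + M (b y - L y (Y x)) - (\<Sum>i\<in>Basis. ((Y y - Y x) \<bullet> i) *\<^sub>R (M (L y i) - i)) = Y y"
    if "y \<in> S" for y
    using linear_system_identity[of M L y Y b x, OF M(1) lin Y] that by simp
  ultimately show ?thesis
    using has_derivative_transform_within_open[OF has_frechet_derivative S] differentiable_def by blast
qed

text \<open>
  Differentiating \<open>L x (Y x) = b x\<close> in the direction \<open>v\<close> shows that the derivative of \<open>Y\<close> solves the
  system with the same \<open>L\<close> and the right-hand side \<open>D\<^sub>v b - (D\<^sub>v L) Y\<close>. This is of class \<open>C\<^sup>k\<close> if \<open>b\<close> is of
  class one higher and \<open>Y\<close> of class \<open>C\<^sup>k\<close>, which makes the induction on \<open>k\<close> work.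
\<close>

lemma Ck_on_linear_solution:
  fixes L :: "'d::euclidean_space \<Rightarrow> 'e::euclidean_space \<Rightarrow> 'e"
  assumes S: "open S" and lin: "\<And>x. x \<in> S \<Longrightarrow> linear (L x)" and inj: "\<And>x. x \<in> S \<Longrightarrow> inj (L x)"
    and L: "\<And>u. smooth_on S (\<lambda>x. L x u)" and b: "Ck_on k S b"
    and Y: "\<And>x. x \<in> S \<Longrightarrow> L x (Y x) = b x"
  shows "Ck_on k S Y"
  using b Y
proof (induction k arbitrary: b Y)
  case 0
  have "isCont Y x" if x: "x \<in> S" for x
    unfolding continuous_at
  proof (rule tendsto_linear_solution[where L = L and b = b and Y = Y, OF S x lin inj[OF x]])
    show "((\<lambda>y. L y u) \<longlongrightarrow> L x u) (at x)" for u
      using smooth_on_continuous[OF L] S x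
      by (simp add: continuous_on_eq_continuous_at continuous_at)
    show "(b \<longlongrightarrow> b x) (at x)"
      using 0 S x by (simp add: continuous_on_eq_continuous_at continuous_at)
  qed (use 0 in auto)
  then show ?case by (simp add: continuous_at_imp_continuous_on)
next
  case (Suc k)
  have dY: "Y differentiable (at x)" if x: "x \<in> S" for x
    by (rule differentiable_linear_solution[where L = L and b = b and Y = Y, OF S x lin inj[OF x]])
      (use x Suc.prems smooth_on_differentiable[OF L] in auto)
  have YC: "Ck_on k S Y" using Suc.IH[OF Ck_on_Suc_imp[OF Suc.prems(1)] Suc.prems(2)] .
  have "Ck_on k S (\<lambda>x. frechet_derivative Y (at x) v)" for v
  proof (rule Suc.IH)
    let ?L' = "\<lambda>x h u. frechet_derivative (\<lambda>y. L y u) (at x) h"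
    let ?r = "\<lambda>x. \<Sum>i\<in>Basis. (Y x \<bullet> i) *\<^sub>R ?L' x v i"
    show "Ck_on k S (\<lambda>x. frechet_derivative b (at x) v + - ?r x)"
    proof (intro Ck_on_add[OF S])
      show "Ck_on k S (\<lambda>x. frechet_derivative b (at x) v)" using Suc.prems by simp
      have "Ck_on k S ?r"
      proof (rule Ck_on_sum[OF S])
        show "Ck_on k S (\<lambda>x. (Y x \<bullet> i) *\<^sub>R ?L' x v i)" for i
          using smooth_on_frechet_derivative[OF L, of i v]
          by (intro Ck_on_bounded_bilinear[OF bounded_bilinear_scaleR S]
            Ck_on_bounded_linear[OF bounded_linear_inner_left S YC]) (simp add: smooth_on_def)
      qed
      then show "Ck_on k S (\<lambda>x. - ?r x)"
        by (rule Ck_on_bounded_linear[OF bounded_linear_minus[OF bounded_linear_ident] S])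
    qed
    fix x assume x: "x \<in> S"
    have L': "((\<lambda>y. L y u) has_derivative (\<lambda>h. ?L' x h u)) (at x)" for u
      using smooth_on_has_derivative[OF L x] by simp
    have "(b has_derivative (\<lambda>h. ?L' x h (Y x) + L x (frechet_derivative Y (at x) h))) (at x)"
      by (rule has_derivative_transform_within_open[OF
            has_derivative_linear_apply[where L = L, OF S x lin L' has_frechet_derivative[OF dY[OF x]]] S x])
        (use Suc.prems in auto)
    from frechet_derivative_eqI[OF this]
    have 1: "frechet_derivative b (at x) v = ?L' x v (Y x) + L x (frechet_derivative Y (at x) v)" by simp
    have "((\<lambda>y. \<Sum>i\<in>Basis. (Y x \<bullet> i) *\<^sub>R L y i) has_derivative (\<lambda>h. \<Sum>i\<in>Basis. (Y x \<bullet> i) *\<^sub>R ?L' x h i)) (at x)"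
      by (intro has_derivative_sum has_derivative_scaleR_right L')
    then have "((\<lambda>y. L y (Y x)) has_derivative (\<lambda>h. \<Sum>i\<in>Basis. (Y x \<bullet> i) *\<^sub>R ?L' x h i)) (at x)"
      by (rule has_derivative_transform_within_open[OF _ S x]) (metis lin linear_eq_sum_Basis)
    from frechet_derivative_eqI[OF this] have "?L' x v (Y x) = ?r x" by simp
    with 1 show "L x (frechet_derivative Y (at x) v) = frechet_derivative b (at x) v + - ?r x" by simp
  qed
  with dY show ?case by simp
qed

lemma smooth_on_linear_solution:
  fixes L :: "'d::euclidean_space \<Rightarrow> 'e::euclidean_space \<Rightarrow> 'e"
  assumes "open S" "\<And>x. x \<in> S \<Longrightarrow> linear (L x)" "\<And>x. x \<in> S \<Longrightarrow> inj (L x)"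
    "\<And>u. smooth_on S (\<lambda>x. L x u)" "smooth_on S b" "\<And>x. x \<in> S \<Longrightarrow> L x (Y x) = b x"
  shows "smooth_on S Y"
  unfolding smooth_on_def
proof
  show "Ck_on k S Y" for k
    by (rule Ck_on_linear_solution[where L = L and b = b])
      (use assms in \<open>auto simp: smooth_on_def[of S b]\<close>)
qed

section \<open>Symmetry of the second derivative\<close>

lemma frechet_derivative_along_line:
  fixes f :: "'e::real_normed_vector \<Rightarrow> real"
  assumes "f differentiable (at (x + t *\<^sub>R u))"
  shows "((\<lambda>s. f (x + s *\<^sub>R u)) has_real_derivative frechet_derivative f (at (x + t *\<^sub>R u)) u) (at t)"
proof -
  let ?D = "frechet_derivative f (at (x + t *\<^sub>R u))"
  have D: "(f has_derivative ?D) (at (x + t *\<^sub>R u))" using has_frechet_derivative[OF assms] .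
  have "((\<lambda>s. x + s *\<^sub>R u) has_derivative (\<lambda>s. s *\<^sub>R u)) (at t)"
    by (auto intro!: derivative_eq_intros)
  from has_derivative_compose[OF this D]
  have "((\<lambda>s. f (x + s *\<^sub>R u)) has_derivative (\<lambda>s. ?D (s *\<^sub>R u))) (at t)" .
  moreover have "(\<lambda>s. ?D (s *\<^sub>R u)) = (*) (?D u)"
    using linear_cmul[OF has_derivative_linear[OF D]] by (auto simp: mult.commute)
  ultimately show ?thesis by (simp add: has_field_derivative_def)
qed

text \<open>
  The second difference over the parallelogram spanned by \<open>h u\<close> and \<open>h v\<close> is \<open>h\<^sup>2\<close> times a mixed second
  derivative at a point of the parallelogram, by the mean value theorem applied in each direction.
  It is symmetric in \<open>u\<close> and \<open>v\<close>, which yields the symmetry of the second derivative in the limit.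
\<close>

lemma second_difference_mvt:
  fixes f :: "'e::real_normed_vector \<Rightarrow> real"
  assumes h: "h > 0"
    and d1: "\<And>s t. 0 \<le> s \<Longrightarrow> s \<le> h \<Longrightarrow> 0 \<le> t \<Longrightarrow> t \<le> h
      \<Longrightarrow> f differentiable (at (x + s *\<^sub>R u + t *\<^sub>R v))"
    and d2: "\<And>s t. 0 \<le> s \<Longrightarrow> s \<le> h \<Longrightarrow> 0 \<le> t \<Longrightarrow> t \<le> h
      \<Longrightarrow> (\<lambda>y. frechet_derivative f (at y) u) differentiable (at (x + s *\<^sub>R u + t *\<^sub>R v))"
  obtains s t where "0 \<le> s" "s \<le> h" "0 \<le> t" "t \<le> h"
    "f (x + h *\<^sub>R u + h *\<^sub>R v) - f (x + h *\<^sub>R u) - f (x + h *\<^sub>R v) + f x =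
      h * h * frechet_derivative (\<lambda>y. frechet_derivative f (at y) u) (at (x + s *\<^sub>R u + t *\<^sub>R v)) v"
proof -
  let ?F = "\<lambda>y. frechet_derivative f (at y) u"
  define p where "p s = f ((x + h *\<^sub>R v) + s *\<^sub>R u) - f (x + s *\<^sub>R u)" for s
  have p: "(p has_real_derivative ?F ((x + h *\<^sub>R v) + s *\<^sub>R u) - ?F (x + s *\<^sub>R u)) (at s)"
    if "0 \<le> s" "s \<le> h" for s
    unfolding p_def
    by (intro DERIV_diff frechet_derivative_along_line)
      (use d1[of s h] d1[of s 0] that h in \<open>auto simp: algebra_simps\<close>)
  obtain s where s: "0 < s" "s < h" "p h - p 0 = (h - 0) * (?F ((x + h *\<^sub>R v) + s *\<^sub>R u) - ?F (x + s *\<^sub>R u))"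
    using MVT2[OF h p] by blast
  define q where "q t = ?F ((x + s *\<^sub>R u) + t *\<^sub>R v)" for t
  have q: "(q has_real_derivative frechet_derivative ?F (at ((x + s *\<^sub>R u) + t *\<^sub>R v)) v) (at t)"
    if "0 \<le> t" "t \<le> h" for t
    unfolding q_def by (intro frechet_derivative_along_line d2) (use that s in auto)
  obtain t where t: "0 < t" "t < h" "q h - q 0 = (h - 0) * frechet_derivative ?F (at ((x + s *\<^sub>R u) + t *\<^sub>R v)) v"
    using MVT2[OF h q] by blast
  have "f (x + h *\<^sub>R u + h *\<^sub>R v) - f (x + h *\<^sub>R u) - f (x + h *\<^sub>R v) + f x = p h - p 0"
    by (simp add: p_def algebra_simps)
  also have "\<dots> = h * (q h - q 0)" using s by (simp add: q_def algebra_simps)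
  also have "\<dots> = h * h * frechet_derivative ?F (at (x + s *\<^sub>R u + t *\<^sub>R v)) v" using t by simp
  finally show ?thesis using that[of s t] s t by simp
qed

lemma symmetric_second_derivative:
  fixes f :: "'e::euclidean_space \<Rightarrow> real"
  assumes S: "open S" "x \<in> S" and f: "smooth_on S f"
  shows "frechet_derivative (\<lambda>y. frechet_derivative f (at y) u) (at x) v =
    frechet_derivative (\<lambda>y. frechet_derivative f (at y) v) (at x) u"
proof -
  let ?G = "\<lambda>u v y. frechet_derivative (\<lambda>y. frechet_derivative f (at y) u) (at y) v"
  have lim: "\<exists>d>0. \<forall>y. dist y x < d \<longrightarrow> dist (?G u v y) (?G u v x) < e" if "e > 0" for u v e
  proof -
    have "isCont (?G u v) x"
      using smooth_on_continuous[OF smooth_on_frechet_derivative[OF smooth_on_frechet_derivative[OF f]]] S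
      by (simp add: continuous_on_eq_continuous_at)
    then show ?thesis using that by (auto simp: continuous_at_eps_delta)
  qed
  have D1: "f differentiable (at y)" if "y \<in> S" for y
    using smooth_on_differentiable[OF f that] .
  have D2: "(\<lambda>y. frechet_derivative f (at y) w) differentiable (at y)" if "y \<in> S" for w y
    using smooth_on_differentiable[OF smooth_on_frechet_derivative[OF f] that] .
  have "\<bar>?G u v x - ?G v u x\<bar> \<le> 0 + e" if e: "e > 0" for e
  proof -
    obtain r where r: "r > 0" "ball x r \<subseteq> S" using S openE by blast
    obtain d1 where d1: "d1 > 0" "\<And>y. dist y x < d1 \<Longrightarrow> dist (?G u v y) (?G u v x) < e / 2"
      using lim[of "e/2" u v] e by auto
    obtain d2 where d2: "d2 > 0" "\<And>y. dist y x < d2 \<Longrightarrow> dist (?G v u y) (?G v u x) < e / 2"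
      using lim[of "e/2" v u] e by auto
    define d where "d = min r (min d1 d2)"
    \<comment> \<open>This \<open>h\<close> keeps the whole parallelogram inside the ball of radius \<open>d\<close>.\<close>
    define N where "N = norm u + norm v + 1"
    define h where "h = d / N / 2"
    have d: "d > 0" using r d1 d2 by (simp add: d_def)
    have nz: "N > 0" unfolding N_def by (smt (verit) norm_ge_zero)
    have h: "h > 0" using d nz by (simp add: h_def)
    have near: "dist (x + s *\<^sub>R u + t *\<^sub>R v) x < d" if "0 \<le> s" "s \<le> h" "0 \<le> t" "t \<le> h" for s t
    proof -
      have "dist (x + s *\<^sub>R u + t *\<^sub>R v) x = norm (s *\<^sub>R u + t *\<^sub>R v)" by (simp add: dist_norm)
      also have "\<dots> \<le> s * norm u + t * norm v"
        using norm_triangle_ineq[of "s *\<^sub>R u" "t *\<^sub>R v"] that by simp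
      also have "\<dots> \<le> h * norm u + h * norm v" using that by (intro add_mono mult_right_mono) auto
      also have "\<dots> \<le> h * (norm u + norm v + 1)" using h by (simp add: algebra_simps)
      also have "\<dots> = d / 2" unfolding h_def N_def[symmetric] using nz by simp
      finally show ?thesis using d by simp
    qed
    have near': "x + s *\<^sub>R u + t *\<^sub>R v \<in> S" "x + s *\<^sub>R v + t *\<^sub>R u \<in> S"
      if "0 \<le> s" "s \<le> h" "0 \<le> t" "t \<le> h" for s t
      using near[OF that] near[OF that(3,4) that(1,2)] r(2)
      by (auto simp: d_def dist_commute subset_iff algebra_simps)
    obtain s t where st: "0 \<le> s" "s \<le> h" "0 \<le> t" "t \<le> h"
      "f (x + h *\<^sub>R u + h *\<^sub>R v) - f (x + h *\<^sub>R u) - f (x + h *\<^sub>R v) + f x =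
        h * h * ?G u v (x + s *\<^sub>R u + t *\<^sub>R v)"
      using second_difference_mvt[OF h D1[OF near'(1)] D2[OF near'(1)]] by blast
    obtain s' t' where st': "0 \<le> s'" "s' \<le> h" "0 \<le> t'" "t' \<le> h"
      "f (x + h *\<^sub>R v + h *\<^sub>R u) - f (x + h *\<^sub>R v) - f (x + h *\<^sub>R u) + f x =
        h * h * ?G v u (x + s' *\<^sub>R v + t' *\<^sub>R u)"
      using second_difference_mvt[OF h D1[OF near'(2)] D2[OF near'(2)]] by blast
    have eq: "?G u v (x + s *\<^sub>R u + t *\<^sub>R v) = ?G v u (x + s' *\<^sub>R v + t' *\<^sub>R u)"
    proof -
      have "h * h * ?G u v (x + s *\<^sub>R u + t *\<^sub>R v) = h * h * ?G v u (x + s' *\<^sub>R v + t' *\<^sub>R u)"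
        unfolding st(5)[symmetric] st'(5)[symmetric] by (simp add: algebra_simps)
      with h show ?thesis by (simp only: mult_cancel_left) simp
    qed
    have "dist (?G u v (x + s *\<^sub>R u + t *\<^sub>R v)) (?G u v x) < e / 2"
      using near[OF st(1-4)] by (intro d1) (simp add: d_def)
    moreover have "dist (?G v u (x + s' *\<^sub>R v + t' *\<^sub>R u)) (?G v u x) < e / 2"
      using near[OF st'(3,4) st'(1,2)] by (intro d2) (simp add: d_def algebra_simps)
    ultimately show ?thesis using eq unfolding dist_real_def by linarith
  qed
  then have "\<bar>?G u v x - ?G v u x\<bar> \<le> 0" by (rule field_le_epsilon)
  then show ?thesis by simp
qed

section \<open>Charts and smooth maps of manifolds\<close>

text \<open>
  A topological atlas: charts covering the space, without any compatibility of the charts. The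
  closure properties of smooth maps below need no more, so that product atlases can be used without
  proving that they are smooth manifolds.
\<close>

definition topological_atlas :: "('a::topological_space, 'e::euclidean_space) chart set \<Rightarrow> bool" where
  "topological_atlas M \<longleftrightarrow> (\<forall>c\<in>M. is_chart c) \<and> (\<Union>c\<in>M. fst c) = UNIV"

lemma smooth_manifold_topological_atlas: "smooth_manifold M \<Longrightarrow> topological_atlas M"
  unfolding smooth_manifold_def topological_atlas_def by blast

lemma topological_atlas_is_chart: "topological_atlas M \<Longrightarrow> c \<in> M \<Longrightarrow> is_chart c"
  unfolding topological_atlas_def by blast

lemma topological_atlas_chart_around:
  assumes "topological_atlas M" obtains c where "c \<in> M" "p \<in> fst c"
  using assms unfolding topological_atlas_def by blast

lemma chart_at:
  assumes "topological_atlas M"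
  shows "chart_at M p \<in> M" "p \<in> fst (chart_at M p)"
proof -
  have "\<exists>c. c \<in> M \<and> p \<in> fst c" using topological_atlas_chart_around[OF assms] by blast
  from someI_ex[OF this] show "chart_at M p \<in> M" "p \<in> fst (chart_at M p)"
    unfolding chart_at_def by blast+
qed

context
  fixes c :: "('a::topological_space, 'e::euclidean_space) chart"
  assumes c: "is_chart c"
begin

lemma chart_domain_open: "open (fst c)"
  and chart_image_open: "open (chart_image c)"
  and chart_continuous: "continuous_on (fst c) (snd c)"
  and chart_inv_continuous: "continuous_on (chart_image c) (chart_inv c)"
  and chart_inv_chart: "p \<in> fst c \<Longrightarrow> chart_inv c (snd c p) = p"
  and chart_chart_inv: "x \<in> chart_image c \<Longrightarrow> snd c (chart_inv c x) = x"
  and chart_inv_domain: "x \<in> chart_image c \<Longrightarrow> chart_inv c x \<in> fst c"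
  using c unfolding is_chart_def homeomorphism_def by auto

lemma chart_in_image: "p \<in> fst c \<Longrightarrow> snd c p \<in> chart_image c"
  unfolding chart_image_def by blast

lemma chart_image_Int: "snd c ` (fst c \<inter> T) = chart_image c \<inter> chart_inv c -` T"
proof (intro equalityI subsetI)
  fix x assume "x \<in> snd c ` (fst c \<inter> T)"
  then show "x \<in> chart_image c \<inter> chart_inv c -` T"
    using chart_inv_chart chart_in_image by auto
next
  fix x assume x: "x \<in> chart_image c \<inter> chart_inv c -` T"
  then have "x = snd c (chart_inv c x)" "chart_inv c x \<in> fst c \<inter> T"
    using chart_chart_inv chart_inv_domain by auto
  then show "x \<in> snd c ` (fst c \<inter> T)" by blast
qed

lemma chart_image_Int_open: "open T \<Longrightarrow> open (snd c ` (fst c \<inter> T))"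
  unfolding chart_image_Int
  using continuous_on_open_vimage[OF chart_image_open] chart_inv_continuous by (metis Int_commute)

end

text \<open>
  The last statement is restricted to the image of the product chart, where alone \<open>chart_inv\<close> is
  meaningful.
\<close>

lemma is_chart_prod:
  assumes c: "is_chart c" and d: "is_chart d"
  shows "is_chart (fst c \<times> fst d, map_prod (snd c) (snd d))" (is "is_chart ?p")
    and "chart_image (fst c \<times> fst d, map_prod (snd c) (snd d)) = chart_image c \<times> chart_image d"
    and "\<And>z. z \<in> chart_image c \<times> chart_image d \<Longrightarrow>
      chart_inv (fst c \<times> fst d, map_prod (snd c) (snd d)) z = (chart_inv c (fst z), chart_inv d (snd z))"
proof -
  show im: "chart_image ?p = chart_image c \<times> chart_image d"
    unfolding chart_image_def by (auto simp: map_prod_surj_on)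
  have "inj_on (snd c) (fst c)" "inj_on (snd d) (fst d)"
    using chart_inv_chart[OF c] chart_inv_chart[OF d] by (metis inj_onI)+
  then have inj: "inj_on (snd ?p) (fst ?p)" by (auto simp: inj_on_def)
  show inv: "chart_inv ?p z = (chart_inv c (fst z), chart_inv d (snd z))"
    if z: "z \<in> chart_image c \<times> chart_image d" for z
  proof -
    let ?w = "(chart_inv c (fst z), chart_inv d (snd z))"
    have "?w \<in> fst ?p" "snd ?p ?w = z"
      using z chart_inv_domain[OF c] chart_inv_domain[OF d] chart_chart_inv[OF c] chart_chart_inv[OF d]
      by auto
    then show ?thesis unfolding chart_inv_def[of ?p] using inv_into_f_f[OF inj] by metis
  qed
  have cont: "continuous_on (chart_image ?p) (chart_inv ?p)"
  proof -
    have "continuous_on (chart_image c \<times> chart_image d) (\<lambda>z. (chart_inv c (fst z), chart_inv d (snd z)))"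
      by (intro continuous_on_Pair continuous_on_compose2[OF chart_inv_continuous[OF c]]
          continuous_on_compose2[OF chart_inv_continuous[OF d]] continuous_on_fst continuous_on_snd
          continuous_on_id) auto
    then show ?thesis unfolding im by (rule continuous_on_eq) (use inv in auto)
  qed
  have "continuous_on (fst c \<times> fst d) (\<lambda>z. (snd c (fst z), snd d (snd z)))"
    by (intro continuous_on_Pair continuous_on_compose2[OF chart_continuous[OF c]]
        continuous_on_compose2[OF chart_continuous[OF d]] continuous_on_fst continuous_on_snd
        continuous_on_id) auto
  then have cont': "continuous_on (fst ?p) (snd ?p)" by (simp add: map_prod_def case_prod_unfold)
  have "homeomorphism (fst ?p) (chart_image ?p) (snd ?p) (chart_inv ?p)"
  proof (rule homeomorphismI[OF cont' cont])
    show "snd ?p ` fst ?p \<subseteq> chart_image ?p" by (simp add: chart_image_def)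
    show "chart_inv ?p ` chart_image ?p \<subseteq> fst ?p"
      unfolding chart_inv_def chart_image_def by (intro image_subsetI inv_into_into)
    show "chart_inv ?p (snd ?p x) = x" if "x \<in> fst ?p" for x
      unfolding chart_inv_def using inv_into_f_f[OF inj that] .
    show "snd ?p (chart_inv ?p y) = y" if "y \<in> chart_image ?p" for y
      using that unfolding chart_inv_def chart_image_def by (rule f_inv_into_f)
  qed
  moreover have "open (fst ?p)" "open (chart_image ?p)"
    unfolding im using chart_domain_open[OF c] chart_domain_open[OF d]
      chart_image_open[OF c] chart_image_open[OF d] by (auto intro: open_Times)
  ultimately show "is_chart ?p" unfolding is_chart_def by blast
qed

lemma topological_atlas_prod:
  assumes "topological_atlas M" "topological_atlas N"
  shows "topological_atlas (prod_atlas M N)"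
  unfolding topological_atlas_def
proof
  show "\<forall>c\<in>prod_atlas M N. is_chart c"
    using is_chart_prod(1) assms unfolding topological_atlas_def prod_atlas_def by blast
  have "(p, q) \<in> (\<Union>c\<in>prod_atlas M N. fst c)" for p q
  proof -
    obtain c d where "c \<in> M" "p \<in> fst c" "d \<in> N" "q \<in> fst d"
      using topological_atlas_chart_around assms by metis
    then have "(fst c \<times> fst d, map_prod (snd c) (snd d)) \<in> prod_atlas M N" "(p, q) \<in> fst c \<times> fst d"
      unfolding prod_atlas_def by blast+
    then show ?thesis by force
  qed
  then show "(\<Union>c\<in>prod_atlas M N. fst c) = UNIV" by auto
qed

lemma chart_inv_real [simp]: "chart_inv (UNIV, id) = id"
  unfolding chart_inv_def by (simp add: fun_eq_iff)

lemma topological_atlas_real: "topological_atlas real_atlas"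
  unfolding topological_atlas_def real_atlas_def is_chart_def chart_image_def
  by (simp add: homeomorphism_def continuous_on_id[unfolded id_def[symmetric]])

lemma smooth_map_onD:
  assumes "smooth_map_on M N S f" "c \<in> M" "d \<in> N"
  shows "smooth_on (snd c ` (fst c \<inter> S \<inter> f -` fst d)) (\<lambda>x. snd d (f (chart_inv c x)))"
  using assms unfolding smooth_map_on_def o_def by blast

lemma smooth_map_on_domain_open:
  assumes "is_chart c" "is_chart d" "continuous_on S f" "open S"
  shows "open (snd c ` (fst c \<inter> S \<inter> f -` fst d))"
proof -
  have "open (S \<inter> f -` fst d)"
    using continuous_open_preimage[OF assms(3,4) chart_domain_open[OF assms(2)]] .
  from chart_image_Int_open[OF assms(1) this] show ?thesis by (simp add: Int_assoc)
qed

lemma smooth_map_on_compose: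
  assumes M: "topological_atlas M" and N: "topological_atlas N" and P: "topological_atlas P"
    and f: "smooth_map_on M N S f" "open S" and g: "smooth_map_on N P T g" "open T"
    and im: "f ` S \<subseteq> T"
  shows "smooth_map_on M P S (g \<circ> f)"
proof -
  have fc: "continuous_on S f" and gc: "continuous_on T g"
    using f g unfolding smooth_map_on_def by auto
  have "smooth_on (snd c ` (fst c \<inter> S \<inter> (g \<circ> f) -` fst e)) (snd e \<circ> (g \<circ> f) \<circ> chart_inv c)"
    if c: "c \<in> M" and e: "e \<in> P" for c e
  proof (rule smooth_on_local)
    fix x assume "x \<in> snd c ` (fst c \<inter> S \<inter> (g \<circ> f) -` fst e)"
    then obtain p where p: "p \<in> fst c" "p \<in> S" "g (f p) \<in> fst e" "x = snd c p" by auto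
    obtain d where d: "d \<in> N" "f p \<in> fst d" using topological_atlas_chart_around[OF N] by blast
    have ch: "is_chart c" "is_chart d" "is_chart e"
      using c d e M N P topological_atlas_is_chart by blast+
    let ?T = "T \<inter> g -` fst e \<inter> fst d"
    let ?S = "S \<inter> f -` ?T"
    let ?U = "snd c ` (fst c \<inter> ?S)"
    let ?V = "snd d ` (fst d \<inter> T \<inter> g -` fst e)"
    have "open (T \<inter> g -` fst e)"
      using continuous_open_preimage[OF gc g(2) chart_domain_open[OF ch(3)]] .
    then have "open ?S"
      using continuous_open_preimage[OF fc f(2)] chart_domain_open[OF ch(2)] by blast
    then have oU: "open ?U" by (rule chart_image_Int_open[OF ch(1)])
    have oV: "open ?V" by (rule smooth_map_on_domain_open[OF ch(2,3) gc g(2)])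
    have fin: "smooth_on ?U (\<lambda>y. snd d (f (chart_inv c y)))"
      by (rule smooth_on_subset[OF smooth_map_onD[OF f(1) c d(1)]]) auto
    have im': "(\<lambda>y. snd d (f (chart_inv c y))) ` ?U \<subseteq> ?V"
      using chart_inv_chart[OF ch(1)] by auto
    have "smooth_on ?U (\<lambda>y. snd e (g (chart_inv d (snd d (f (chart_inv c y))))))"
      by (rule smooth_on_compose[OF oU oV fin smooth_map_onD[OF g(1) d(1) e] im'])
    then have "smooth_on ?U (snd e \<circ> (g \<circ> f) \<circ> chart_inv c)"
      by (rule smooth_on_cong[OF oU, rotated])
        (auto simp: chart_inv_chart[OF ch(1)] chart_inv_chart[OF ch(2)])
    moreover have "x \<in> ?U" using p d im by auto
    ultimately show "\<exists>T. open T \<and> x \<in> T \<and> smooth_on T (snd e \<circ> (g \<circ> f) \<circ> chart_inv c)"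
      using oU by blast
  qed
  moreover have "continuous_on S (g \<circ> f)"
    using continuous_on_compose[OF fc] continuous_on_subset[OF gc im] by blast
  ultimately show ?thesis unfolding smooth_map_on_def by blast
qed

lemma smooth_map_on_const: "smooth_map_on M N S (\<lambda>_. q)"
  unfolding smooth_map_on_def by (auto simp: o_def smooth_on_const)

lemma smooth_map_on_ident: "smooth_manifold M \<Longrightarrow> smooth_map_on M M S (\<lambda>p. p)"
  unfolding smooth_map_on_def
proof (intro conjI ballI)
  fix c d assume M: "smooth_manifold M" and "c \<in> M" "d \<in> M"
  then have "smooth_on (snd c ` (fst c \<inter> fst d)) (snd d \<circ> chart_inv c)"
    unfolding smooth_manifold_def by blast
  then show "smooth_on (snd c ` (fst c \<inter> S \<inter> (\<lambda>p. p) -` fst d)) (snd d \<circ> (\<lambda>p. p) \<circ> chart_inv c)"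
    unfolding o_def by (rule smooth_on_subset) auto
qed (rule continuous_on_id)

lemma smooth_map_on_Pair:
  assumes M: "topological_atlas M" and N: "topological_atlas N" and P: "topological_atlas P"
    and "open S" and f: "smooth_map_on M N S f" and g: "smooth_map_on M P S g"
  shows "smooth_map_on M (prod_atlas N P) S (\<lambda>p. (f p, g p))"
  unfolding smooth_map_on_def
proof (intro conjI ballI)
  have fc: "continuous_on S f" and gc: "continuous_on S g"
    using f g unfolding smooth_map_on_def by auto
  then show cont: "continuous_on S (\<lambda>p. (f p, g p))" by (rule continuous_on_Pair)
  fix c e assume c: "c \<in> M" and "e \<in> prod_atlas N P"
  then obtain d d' where e: "e = (fst d \<times> fst d', map_prod (snd d) (snd d'))" and d: "d \<in> N" "d' \<in> P"
    unfolding prod_atlas_def by blast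
  have "is_chart e"
    using topological_atlas_is_chart[OF topological_atlas_prod[OF N P] \<open>e \<in> prod_atlas N P\<close>] .
  let ?U = "snd c ` (fst c \<inter> S \<inter> (\<lambda>p. (f p, g p)) -` fst e)"
  have "open ?U"
    by (rule smooth_map_on_domain_open[OF topological_atlas_is_chart[OF M c] \<open>is_chart e\<close> cont assms(4)])
  then have "smooth_on ?U (\<lambda>x. (snd d (f (chart_inv c x)), snd d' (g (chart_inv c x))))"
    by (intro smooth_on_Pair smooth_on_subset[OF smooth_map_onD[OF f c d(1)]]
        smooth_on_subset[OF smooth_map_onD[OF g c d(2)]]) (auto simp: e)
  then show "smooth_on ?U (snd e \<circ> (\<lambda>p. (f p, g p)) \<circ> chart_inv c)"
    by (simp add: e o_def)
qed

lemma smooth_functions_iff: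
  assumes M: "topological_atlas M"
  shows "f \<in> smooth_functions M \<longleftrightarrow> (\<forall>c\<in>M. smooth_on (chart_image c) (\<lambda>x. f (chart_inv c x)))"
proof
  assume "f \<in> smooth_functions M"
  then show "\<forall>c\<in>M. smooth_on (chart_image c) (\<lambda>x. f (chart_inv c x))"
    unfolding smooth_functions_def smooth_map_on_def real_atlas_def chart_image_def by (simp add: o_def)
next
  assume s: "\<forall>c\<in>M. smooth_on (chart_image c) (\<lambda>x. f (chart_inv c x))"
  have "continuous_on (fst c) f" if "c \<in> M" for c
  proof -
    have ch: "is_chart c" using topological_atlas_is_chart[OF M that] .
    have "continuous_on (fst c) (\<lambda>q. f (chart_inv c (snd c q)))"
      using continuous_on_compose2[OF smooth_on_continuous[OF s[rule_format, OF that]]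
          chart_continuous[OF ch]] by (simp add: chart_image_def)
    then show ?thesis
      by (rule continuous_on_eq) (simp add: chart_inv_chart[OF ch])
  qed
  then have "continuous_on (\<Union>c\<in>M. fst c) f"
    using chart_domain_open[OF topological_atlas_is_chart[OF M]]
    by (intro continuous_on_open_UN) auto
  then have "continuous_on UNIV f" using M unfolding topological_atlas_def by simp
  with s show "f \<in> smooth_functions M"
    unfolding smooth_functions_def smooth_map_on_def real_atlas_def chart_image_def by (simp add: o_def)
qed

lemma smooth_functions_compose:
  assumes "topological_atlas M" "topological_atlas N" "smooth_map_on M N UNIV f" "h \<in> smooth_functions N"
  shows "h \<circ> f \<in> smooth_functions M"
  using smooth_map_on_compose[OF assms(1,2) topological_atlas_real assms(3) open_UNIV _ open_UNIV] assms(4)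
  unfolding smooth_functions_def by blast

lemma
  assumes M: "topological_atlas M" and f: "f \<in> smooth_functions M"
  shows smooth_functions_add: "g \<in> smooth_functions M \<Longrightarrow> (\<lambda>p. f p + g p) \<in> smooth_functions M"
    and smooth_functions_scale: "(\<lambda>p. r * f p) \<in> smooth_functions M"
    and smooth_functions_mult: "g \<in> smooth_functions M \<Longrightarrow> (\<lambda>p. f p * g p) \<in> smooth_functions M"
  using f chart_image_open[OF topological_atlas_is_chart[OF M]]
  unfolding smooth_functions_iff[OF M]
  by (simp_all add: smooth_on_add smooth_on_bounded_linear[OF bounded_linear_mult_right]
      smooth_on_bounded_bilinear[OF bounded_bilinear_mult])

section \<open>Tangent spaces and differentials\<close>

context
  fixes M :: "('a::{t2_space,second_countable_topology}, 'e::euclidean_space) chart set"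
  assumes M: "smooth_manifold M"
begin

lemma manifold_is_chart: "c \<in> M \<Longrightarrow> is_chart c"
  using M unfolding smooth_manifold_def by blast

lemma transition_differentiable:
  assumes "c \<in> M" "d \<in> M" "p \<in> fst c" "p \<in> fst d"
  shows "(snd d \<circ> chart_inv c) differentiable (at (snd c p))"
  using M assms unfolding smooth_manifold_def by (intro smooth_on_differentiable) blast+

text \<open>
  The chain rule through a transition map. For \<open>h\<close> a third coordinate map it is the cocycle
  condition that makes \<open>coord_vector\<close> a tangent vector.
\<close>

lemma frechet_derivative_change_chart:
  fixes h :: "'a \<Rightarrow> 'g::euclidean_space"
  assumes cd: "c \<in> M" "d \<in> M" "p \<in> fst c" "p \<in> fst d"
    and h: "(h \<circ> chart_inv d) differentiable (at (snd d p))"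
  shows "frechet_derivative (h \<circ> chart_inv c) (at (snd c p)) =
    (\<lambda>u. frechet_derivative (h \<circ> chart_inv d) (at (snd d p))
      (frechet_derivative (snd d \<circ> chart_inv c) (at (snd c p)) u))"
proof (rule frechet_derivative_eqI)
  have c: "is_chart c" and d: "is_chart d" using cd manifold_is_chart by auto
  have eq: "(snd d \<circ> chart_inv c) (snd c p) = snd d p" using chart_inv_chart[OF c cd(3)] by simp
  have "((\<lambda>x. (h \<circ> chart_inv d) ((snd d \<circ> chart_inv c) x)) has_derivative
    (\<lambda>u. frechet_derivative (h \<circ> chart_inv d) (at (snd d p))
      (frechet_derivative (snd d \<circ> chart_inv c) (at (snd c p)) u))) (at (snd c p))"
    using has_derivative_compose[OF has_frechet_derivative[OF transition_differentiable[OF cd]],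
        where g = "h \<circ> chart_inv d"] has_frechet_derivative[OF h] unfolding eq by blast
  then show "((h \<circ> chart_inv c) has_derivative
    (\<lambda>u. frechet_derivative (h \<circ> chart_inv d) (at (snd d p))
      (frechet_derivative (snd d \<circ> chart_inv c) (at (snd c p)) u))) (at (snd c p))"
  proof (rule has_derivative_transform_within_open)
    show "open (snd c ` (fst c \<inter> fst d))"
      by (rule chart_image_Int_open[OF c chart_domain_open[OF d]])
    show "snd c p \<in> snd c ` (fst c \<inter> fst d)" using cd by blast
  qed (auto simp: chart_inv_chart[OF c] chart_inv_chart[OF d])
qed

lemma frechet_derivative_transition_self:
  assumes "c \<in> M" "p \<in> fst c"
  shows "frechet_derivative (snd c \<circ> chart_inv c) (at (snd c p)) = (\<lambda>u. u)"
proof (rule frechet_derivative_eqI, rule has_derivative_transform_within_open[OF has_derivative_ident])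
  note c = manifold_is_chart[OF assms(1)]
  show "open (chart_image c)" "snd c p \<in> chart_image c"
    using chart_image_open[OF c] chart_in_image[OF c assms(2)] by auto
qed (use chart_chart_inv[OF manifold_is_chart[OF assms(1)]] in auto)

lemma coord_vector_in_tangent_space:
  assumes "c \<in> M" "p \<in> fst c"
  shows "coord_vector M c p u \<in> tangent_space M p"
  unfolding tangent_space_def
proof (intro CollectI conjI ballI impI allI)
  fix d e assume de: "d \<in> M" "e \<in> M" "p \<in> fst d \<inter> fst e"
  show "coord_vector M c p u e =
      frechet_derivative (snd e \<circ> chart_inv d) (at (snd d p)) (coord_vector M c p u d)"
    unfolding coord_vector_def
    using frechet_derivative_change_chart[of c d p "snd e"] transition_differentiable[of d e p] assms de
    by simp
qed (auto simp: coord_vector_def)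

lemma coord_vector_self: "c \<in> M \<Longrightarrow> p \<in> fst c \<Longrightarrow> coord_vector M c p u c = u"
  unfolding coord_vector_def by (simp add: frechet_derivative_transition_self)

lemma tangent_eq_coord_vector:
  assumes "c \<in> M" "p \<in> fst c" "v \<in> tangent_space M p"
  shows "v = coord_vector M c p (v c)"
proof
  fix d
  have v: "\<And>d. d \<in> M \<Longrightarrow> p \<in> fst c \<inter> fst d \<Longrightarrow>
      v d = frechet_derivative (snd d \<circ> chart_inv c) (at (snd c p)) (v c)"
    "\<And>d. d \<notin> M \<or> p \<notin> fst d \<Longrightarrow> v d = 0"
    using assms unfolding tangent_space_def by blast+
  show "v d = coord_vector M c p (v c) d"
    unfolding coord_vector_def using v[of d] assms(2) by auto
qed

lemma tangent_eqI:
  assumes "c \<in> M" "p \<in> fst c" "v \<in> tangent_space M p" "w \<in> tangent_space M p" "v c = w c"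
  shows "v = w"
  using tangent_eq_coord_vector[OF assms(1,2)] assms(3-5) by metis

lemma coord_vector_add:
  assumes "c \<in> M" "p \<in> fst c"
  shows "coord_vector M c p (u + v) = (\<lambda>d. coord_vector M c p u d + coord_vector M c p v d)"
proof
  fix d show "coord_vector M c p (u + v) d = coord_vector M c p u d + coord_vector M c p v d"
    using linear_add[OF linear_frechet_derivative[OF transition_differentiable[of c d p]]] assms
    by (simp add: coord_vector_def)
qed

lemma coord_vector_scaleR:
  assumes "c \<in> M" "p \<in> fst c"
  shows "coord_vector M c p (r *\<^sub>R u) = (\<lambda>d. r *\<^sub>R coord_vector M c p u d)"
proof
  fix d show "coord_vector M c p (r *\<^sub>R u) d = r *\<^sub>R coord_vector M c p u d"
    using linear_cmul[OF linear_frechet_derivative[OF transition_differentiable[of c d p]]] assms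
    by (simp add: coord_vector_def)
qed

lemma smooth_function_differentiable:
  assumes "f \<in> smooth_functions M" "c \<in> M" "p \<in> fst c"
  shows "(f \<circ> chart_inv c) differentiable (at (snd c p))"
  using assms smooth_functions_iff[OF smooth_manifold_topological_atlas[OF M]]
    smooth_on_differentiable chart_in_image[OF manifold_is_chart[OF assms(2)] assms(3)]
  unfolding o_def by blast

lemma differential_in_chart:
  assumes "f \<in> smooth_functions M" "c \<in> M" "p \<in> fst c" "v \<in> tangent_space M p"
  shows "differential M f p v = frechet_derivative (f \<circ> chart_inv c) (at (snd c p)) (v c)"
proof -
  let ?b = "chart_at M p"
  have b: "?b \<in> M" "p \<in> fst ?b" using chart_at[OF smooth_manifold_topological_atlas[OF M]] by auto
  have "v c = frechet_derivative (snd c \<circ> chart_inv ?b) (at (snd ?b p)) (v ?b)"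
    using assms b unfolding tangent_space_def by blast
  then show ?thesis
    using frechet_derivative_change_chart[OF b(1) assms(2) b(2) assms(3)
        smooth_function_differentiable[OF assms(1-3)]]
    unfolding differential_def Let_def by simp
qed

lemma tangent_map_in_chart:
  assumes f: "smooth_map_on M N UNIV f" "c \<in> M" "p \<in> fst c" "v \<in> tangent_space M p"
    and d: "d \<in> N" "f p \<in> fst d"
  shows "tangent_map M N f p v d = frechet_derivative (snd d \<circ> f \<circ> chart_inv c) (at (snd c p)) (v c)"
proof -
  let ?b = "chart_at M p"
  have b: "?b \<in> M" "p \<in> fst ?b" using chart_at[OF smooth_manifold_topological_atlas[OF M]] by auto
  have v: "v c = frechet_derivative (snd c \<circ> chart_inv ?b) (at (snd ?b p)) (v ?b)"
    using assms b unfolding tangent_space_def by blast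
  have "(snd d \<circ> f \<circ> chart_inv c) differentiable (at (snd c p))"
    using smooth_on_differentiable[OF smooth_map_onD[OF f(1,2) d(1)]] f(3) d(2) by (simp add: o_def)
  from frechet_derivative_change_chart[OF b(1) f(2) b(2) f(3) this]
  show ?thesis
    using d v unfolding tangent_map_def Let_def by simp
qed

end

lemma tangent_map_in_tangent_space:
  assumes M: "smooth_manifold M" and N: "smooth_manifold N" and f: "smooth_map_on M N UNIV f"
    and v: "v \<in> tangent_space M p"
  shows "tangent_map M N f p v \<in> tangent_space N (f p)"
  unfolding tangent_space_def
proof (intro CollectI conjI ballI impI allI)
  fix d e assume de: "d \<in> N" "e \<in> N" "f p \<in> fst d \<inter> fst e"
  obtain c where c: "c \<in> M" "p \<in> fst c"
    using topological_atlas_chart_around[OF smooth_manifold_topological_atlas[OF M]] by blast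
  have ch: "is_chart c" "is_chart d" "is_chart e" using c de M N manifold_is_chart by blast+
  have pc: "chart_inv c (snd c p) = p" using chart_inv_chart[OF ch(1) c(2)] .
  let ?f = "snd d \<circ> f \<circ> chart_inv c" and ?t = "snd e \<circ> chart_inv d"
  have df: "?f differentiable (at (snd c p))"
    using smooth_on_differentiable[OF smooth_map_onD[OF f c(1) de(1)]] c(2) de(3) by (simp add: o_def)
  have dt: "?t differentiable (at (?f (snd c p)))"
    using transition_differentiable[OF N de(1,2), of "f p"] de(3) pc by simp
  have "((\<lambda>x. ?t (?f x)) has_derivative (\<lambda>u. frechet_derivative ?t (at (?f (snd c p)))
      (frechet_derivative ?f (at (snd c p)) u))) (at (snd c p))"
    by (rule has_derivative_compose[OF has_frechet_derivative[OF df] has_frechet_derivative[OF dt]])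
  then have "((snd e \<circ> f \<circ> chart_inv c) has_derivative (\<lambda>u. frechet_derivative ?t (at (?f (snd c p)))
      (frechet_derivative ?f (at (snd c p)) u))) (at (snd c p))"
  proof (rule has_derivative_transform_within_open)
    show "open (snd c ` (fst c \<inter> UNIV \<inter> f -` fst d))"
      using smooth_map_on_domain_open[OF ch(1,2) _ open_UNIV] f unfolding smooth_map_on_def by blast
  qed (use c de in \<open>auto simp: chart_inv_chart[OF ch(1)] chart_inv_chart[OF ch(2)]\<close>)
  from frechet_derivative_eqI[OF this]
  show "tangent_map M N f p v e =
      frechet_derivative ?t (at (snd d (f p))) (tangent_map M N f p v d)"
    using tangent_map_in_chart[OF M f c v] de pc by simp
qed (auto simp: tangent_map_def Let_def)

section \<open>The Jacobi identity in coordinates\<close>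

text \<open>
  Write \<open>\<omega>' h\<close> for the derivative of \<open>\<omega>\<close> in the direction \<open>h\<close>. By the product rule, the cyclic sum of the
  derivatives of \<open>\<omega> (Q, R)\<close> along \<open>P\<close> consists of the cyclic sum of \<open>\<omega>' P (Q, R)\<close>, which vanishes
  because \<open>\<omega>\<close> is closed, and of the cyclic sums of \<open>\<omega> (D Q P, R)\<close> and \<open>\<omega> (Q, D R P)\<close>. The latter two
  cancel because \<open>\<omega>' h (Q, v) + \<omega> (D Q h, v)\<close> is a second derivative, hence symmetric in \<open>h\<close> and \<open>v\<close>,
  and because the terms in \<open>\<omega>'\<close> drop out of the cyclic sum of these symmetries, again by closedness.
\<close>

lemma jacobi_in_coordinates:
  fixes \<omega> :: "'e::euclidean_space \<Rightarrow> 'e \<Rightarrow> 'e \<Rightarrow> real"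
  assumes W: "open W" "x \<in> W"
    and lin1: "\<And>y v. y \<in> W \<Longrightarrow> linear (\<lambda>u. \<omega> y u v)"
    and lin2: "\<And>y u. y \<in> W \<Longrightarrow> linear (\<omega> y u)"
    and anti: "\<And>y u v. y \<in> W \<Longrightarrow> \<omega> y u v = - \<omega> y v u"
    and smooth: "\<And>u v. smooth_on W (\<lambda>y. \<omega> y u v)"
    and closed: "\<And>u v w. frechet_derivative (\<lambda>y. \<omega> y v w) (at x) u +
      frechet_derivative (\<lambda>y. \<omega> y w u) (at x) v + frechet_derivative (\<lambda>y. \<omega> y u v) (at x) w = 0"
    and fns: "smooth_on W F" "smooth_on W G" "smooth_on W H"
    and flds: "smooth_on W P" "smooth_on W Q" "smooth_on W R"
    and ham: "\<And>y v. y \<in> W \<Longrightarrow> \<omega> y (P y) v = frechet_derivative F (at y) v"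
      "\<And>y v. y \<in> W \<Longrightarrow> \<omega> y (Q y) v = frechet_derivative G (at y) v"
      "\<And>y v. y \<in> W \<Longrightarrow> \<omega> y (R y) v = frechet_derivative H (at y) v"
  shows "frechet_derivative (\<lambda>y. \<omega> y (Q y) (R y)) (at x) (P x) +
    frechet_derivative (\<lambda>y. \<omega> y (R y) (P y)) (at x) (Q x) +
    frechet_derivative (\<lambda>y. \<omega> y (P y) (Q y)) (at x) (R x) = 0"
proof -
  define \<omega>' where "\<omega>' h u v = frechet_derivative (\<lambda>y. \<omega> y u v) (at x) h" for h u v
  define D where "D X = frechet_derivative X (at x)" for X :: "'e \<Rightarrow> 'e"
  have \<omega>': "((\<lambda>y. \<omega> y u v) has_derivative (\<lambda>h. \<omega>' h u v)) (at x)" for u v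
    unfolding \<omega>'_def using smooth_on_has_derivative[OF smooth W(2)] by simp
  have d1: "((\<lambda>y. \<omega> y (X y) v) has_derivative (\<lambda>h. \<omega>' h (X x) v + \<omega> x (D X h) v)) (at x)"
    if X: "smooth_on W X" for X v
    unfolding D_def
    by (rule has_derivative_linear_apply[where L = "\<lambda>y u. \<omega> y u v" and L' = "\<lambda>h u. \<omega>' h u v",
          OF W lin1 \<omega>' smooth_on_has_derivative[OF X W(2)]])
  have d2: "frechet_derivative (\<lambda>y. \<omega> y (X y) (Y y)) (at x) h =
      \<omega>' h (X x) (Y x) + \<omega> x (D X h) (Y x) + \<omega> x (X x) (D Y h)"
    if X: "smooth_on W X" and Y: "smooth_on W Y" for X Y h
    unfolding D_def[of Y]
    using frechet_derivative_eqI[OF has_derivative_linear_apply[where L = "\<lambda>y. \<omega> y (X y)"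
        and L' = "\<lambda>h v. \<omega>' h (X x) v + \<omega> x (D X h) v", OF W lin2 d1[OF X]
          smooth_on_has_derivative[OF Y W(2)]]]
    by simp
  \<comment> \<open>The derivative of \<open>\<omega> (X, v) = df v\<close> in the direction \<open>h\<close> is the second derivative of \<open>f\<close>.\<close>
  have sym: "\<omega>' h (X x) v + \<omega> x (D X h) v = \<omega>' v (X x) h + \<omega> x (D X v) h"
    if X: "smooth_on W X" and f: "smooth_on W f"
      and h: "\<And>y v. y \<in> W \<Longrightarrow> \<omega> y (X y) v = frechet_derivative f (at y) v" for X f h v
  proof -
    have "frechet_derivative (\<lambda>y. frechet_derivative f (at y) v) (at x) h =
        \<omega>' h (X x) v + \<omega> x (D X h) v" for h v
      using frechet_derivative_eqI[OF has_derivative_transform_within_open[OF d1[OF X] W h]] by simp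
    then show ?thesis using symmetric_second_derivative[OF W f, of v h] by simp
  qed
  have a': "\<omega>' h u v = - \<omega>' h v u" for h u v
  proof -
    have "((\<lambda>y. - \<omega> y v u) has_derivative (\<lambda>h. \<omega>' h u v)) (at x)"
      by (rule has_derivative_transform_within_open[OF \<omega>' W]) (rule anti)
    from fun_cong[OF has_derivative_unique[OF this has_derivative_minus[OF \<omega>']], of h]
    show ?thesis .
  qed
  have c': "\<omega>' u v w + \<omega>' v w u + \<omega>' w u v = 0" for u v w
    using closed[of v w u] unfolding \<omega>'_def .
  note an = anti[OF W(2)]
  show ?thesis
    unfolding d2[OF flds(2,3)] d2[OF flds(3,1)] d2[OF flds(1,2)]
    using sym[OF flds(2) fns(2) ham(2), of "P x" "R x"] sym[OF flds(3) fns(3) ham(3), of "Q x" "P x"]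
      sym[OF flds(1) fns(1) ham(1), of "R x" "Q x"] c'[of "P x" "Q x" "R x"]
      a'[of "R x" "Q x" "P x"] a'[of "P x" "R x" "Q x"] a'[of "Q x" "P x" "R x"]
      an[of "Q x" "D R (P x)"] an[of "R x" "D P (Q x)"] an[of "P x" "D Q (R x)"]
    by linarith
qed

section \<open>The Poisson bracket of a symplectic manifold\<close>

text \<open>A manifold \<open>A\<close> with a symplectic form \<open>\<Omega>\<close>; no bundle structure is involved.\<close>

locale symplectic_manifold =
  fixes A :: "('a::{t2_space,second_countable_topology}, 'e::euclidean_space) chart set"
    and \<Omega> :: "('a, 'e) form2"
  assumes manifold: "smooth_manifold A" and symplectic: "symplectic_form A \<Omega>"
begin

lemmas atlas = smooth_manifold_topological_atlas[OF manifold]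
lemmas is_chart = manifold_is_chart[OF manifold]

lemma
  assumes "v \<in> tangent_space A p" "w \<in> tangent_space A p"
  shows form_add: "v' \<in> tangent_space A p \<Longrightarrow> \<Omega> p (\<lambda>c. v c + v' c) w = \<Omega> p v w + \<Omega> p v' w"
    and form_scaleR: "\<Omega> p (\<lambda>c. r *\<^sub>R v c) w = r * \<Omega> p v w"
    and form_antisym: "\<Omega> p v w = - \<Omega> p w v"
  using symplectic assms unfolding symplectic_form_def differential_form2_def by blast+

lemma form_nondegenerate:
  "v \<in> tangent_space A p \<Longrightarrow> (\<And>w. w \<in> tangent_space A p \<Longrightarrow> \<Omega> p v w = 0) \<Longrightarrow> v = (\<lambda>c. 0)"
  using symplectic unfolding symplectic_form_def by blast

lemma form2_coord_at:
  assumes "c \<in> A" "p \<in> fst c"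
  shows "form2_coord A \<Omega> c (snd c p) u v = \<Omega> p (coord_vector A c p u) (coord_vector A c p v)"
  unfolding form2_coord_def by (simp add: chart_inv_chart[OF is_chart[OF assms(1)] assms(2)])

lemma form_eq_form2_coord:
  assumes "c \<in> A" "p \<in> fst c" "v \<in> tangent_space A p" "w \<in> tangent_space A p"
  shows "\<Omega> p v w = form2_coord A \<Omega> c (snd c p) (v c) (w c)"
  unfolding form2_coord_at[OF assms(1,2)]
  using tangent_eq_coord_vector[OF manifold assms(1,2)] assms(3,4) by metis

context
  fixes c x
  assumes c: "c \<in> A" and x: "x \<in> chart_image c"
begin

lemma form2_coord_antisym: "form2_coord A \<Omega> c x u v = - form2_coord A \<Omega> c x v u"
  unfolding form2_coord_def
  by (intro form_antisym coord_vector_in_tangent_space[OF manifold c chart_inv_domain[OF is_chart[OF c] x]])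

lemma form2_coord_linear_left: "linear (\<lambda>u. form2_coord A \<Omega> c x u v)"
proof -
  have p: "chart_inv c x \<in> fst c" using chart_inv_domain[OF is_chart[OF c] x] .
  note t = coord_vector_in_tangent_space[OF manifold c p]
  show ?thesis
  proof (rule linearI)
    show "form2_coord A \<Omega> c x (u + u') v = form2_coord A \<Omega> c x u v + form2_coord A \<Omega> c x u' v" for u u'
      unfolding form2_coord_def coord_vector_add[OF manifold c p] by (rule form_add[OF t t t])
    show "form2_coord A \<Omega> c x (r *\<^sub>R u) v = r *\<^sub>R form2_coord A \<Omega> c x u v" for r u
      unfolding form2_coord_def coord_vector_scaleR[OF manifold c p] real_scaleR_def
      by (rule form_scaleR[OF t t])
  qed
qed

lemma form2_coord_linear_right: "linear (form2_coord A \<Omega> c x u)"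
  using linear_compose_neg[OF form2_coord_linear_left[of u]] form2_coord_antisym[of u]
  by (metis (no_types, lifting) ext)

lemma form2_coord_nondegenerate:
  assumes "\<And>v. form2_coord A \<Omega> c x u v = 0"
  shows "u = 0"
proof -
  let ?p = "chart_inv c x"
  have p: "?p \<in> fst c" using chart_inv_domain[OF is_chart[OF c] x] .
  note t = coord_vector_in_tangent_space[OF manifold c p]
  have "coord_vector A c ?p u = (\<lambda>c. 0)"
  proof (rule form_nondegenerate[OF t])
    show "\<Omega> ?p (coord_vector A c ?p u) w = 0" if "w \<in> tangent_space A ?p" for w
      using form_eq_form2_coord[OF c p t that] assms chart_chart_inv[OF is_chart[OF c] x]
      by (simp add: coord_vector_self[OF manifold c p])
  qed
  then show ?thesis using coord_vector_self[OF manifold c p, of u] by simp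
qed

end

lemma form2_coord_smooth:
  "c \<in> A \<Longrightarrow> smooth_on (chart_image c) (\<lambda>x. form2_coord A \<Omega> c x u v)"
  using symplectic unfolding symplectic_form_def differential_form2_def by blast

lemma form2_coord_closed:
  "c \<in> A \<Longrightarrow> x \<in> chart_image c \<Longrightarrow> ext_deriv_coord A \<Omega> c x u v w = 0"
  using symplectic unfolding symplectic_form_def by blast

text \<open>
  The linear map that sends \<open>u\<close> to the linear form \<open>\<omega> (u, _)\<close> at the point with coordinates \<open>x\<close>. Linear
  forms are identified with vectors by means of the standard basis, so that \<open>flat c x\<close> is an
  endomorphism.
\<close>

definition flat :: "('a, 'e) chart \<Rightarrow> 'e \<Rightarrow> 'e \<Rightarrow> 'e" where
  "flat c x u = (\<Sum>i\<in>Basis. form2_coord A \<Omega> c x u i *\<^sub>R i)"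

lemma flat_inner: "i \<in> Basis \<Longrightarrow> flat c x u \<bullet> i = form2_coord A \<Omega> c x u i"
  unfolding flat_def by (simp add: inner_sum_left inner_Basis if_distrib cong: if_cong)

lemma flat_linear: "c \<in> A \<Longrightarrow> x \<in> chart_image c \<Longrightarrow> linear (flat c x)"
  using linear_add[OF form2_coord_linear_left] linear_cmul[OF form2_coord_linear_left]
  by (intro linearI) (simp_all add: flat_def scaleR_left_distrib sum.distrib scaleR_sum_right)

lemma flat_smooth: "c \<in> A \<Longrightarrow> smooth_on (chart_image c) (\<lambda>x. flat c x u)"
  unfolding flat_def using chart_image_open[OF is_chart]
  by (intro smooth_on_sum smooth_on_bounded_linear[OF bounded_linear_scaleR_left]
      form2_coord_smooth)

lemma flat_eqI:
  assumes "c \<in> A" "x \<in> chart_image c" "linear l"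
    and "\<And>i. i \<in> Basis \<Longrightarrow> flat c x u \<bullet> i = l i"
  shows "form2_coord A \<Omega> c x u v = l v"
proof -
  have "form2_coord A \<Omega> c x u i = l i" if "i \<in> Basis" for i
    using assms(4)[OF that] flat_inner[OF that] by simp
  from linear_eq_stdbasis[OF form2_coord_linear_right[OF assms(1,2)] assms(3) this]
  show ?thesis by simp
qed

lemma flat_inj: "c \<in> A \<Longrightarrow> x \<in> chart_image c \<Longrightarrow> inj (flat c x)"
  unfolding linear_injective_0[OF flat_linear]
  by (auto intro!: form2_coord_nondegenerate[of c x] flat_eqI[where l = "\<lambda>_. 0"] linear_zero)

lemma flat_surj: "c \<in> A \<Longrightarrow> x \<in> chart_image c \<Longrightarrow> surj (flat c x)"
  using linear_injective_imp_surjective[OF flat_linear] flat_inj by blast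

lemma tangent_vector_unique:
  assumes "v \<in> tangent_space A p" "v' \<in> tangent_space A p"
    and eq: "\<And>w. w \<in> tangent_space A p \<Longrightarrow> \<Omega> p v w = \<Omega> p v' w"
  shows "v = v'"
proof -
  obtain c where c: "c \<in> A" "p \<in> fst c" using topological_atlas_chart_around[OF atlas] by blast
  note x = chart_in_image[OF is_chart[OF c(1)] c(2)]
  note t = coord_vector_in_tangent_space[OF manifold c]
  have "form2_coord A \<Omega> c (snd c p) (v c) u = form2_coord A \<Omega> c (snd c p) (v' c) u" for u
    using eq[OF t] form_eq_form2_coord[OF c _ t] assms(1,2) by (simp add: coord_vector_self[OF manifold c])
  then have "form2_coord A \<Omega> c (snd c p) (v c - v' c) u = 0" for u
    using linear_diff[OF form2_coord_linear_left[OF c(1) x]] by simp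
  then have "v c - v' c = 0" by (rule form2_coord_nondegenerate[OF c(1) x])
  then show ?thesis using tangent_eqI[OF manifold c assms(1,2)] by simp
qed

text \<open>The value at \<open>p\<close> of the Hamiltonian vector field of \<open>F\<close>, without any smoothness in \<open>p\<close>.\<close>

lemma tangent_vector_exists:
  assumes F: "F \<in> smooth_functions A"
  shows "\<exists>v. v \<in> tangent_space A p \<and> (\<forall>w\<in>tangent_space A p. \<Omega> p v w = differential A F p w)"
proof -
  obtain c where c: "c \<in> A" "p \<in> fst c" using topological_atlas_chart_around[OF atlas] by blast
  note x = chart_in_image[OF is_chart[OF c(1)] c(2)]
  note t = coord_vector_in_tangent_space[OF manifold c]
  let ?l = "frechet_derivative (F \<circ> chart_inv c) (at (snd c p))"
  have l: "linear ?l" using smooth_function_differentiable[OF manifold F c] linear_frechet_derivative by blast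
  obtain u where u: "flat c (snd c p) u = (\<Sum>i\<in>Basis. ?l i *\<^sub>R i)"
    using flat_surj[OF c(1) x] by (metis surjD)
  have "form2_coord A \<Omega> c (snd c p) u v = ?l v" for v
    by (rule flat_eqI[OF c(1) x l])
      (simp add: u inner_sum_left inner_Basis if_distrib cong: if_cong)
  then have "\<Omega> p (coord_vector A c p u) w = differential A F p w" if "w \<in> tangent_space A p" for w
    using form_eq_form2_coord[OF c t that] differential_in_chart[OF manifold F c that]
    by (simp add: coord_vector_self[OF manifold c])
  with t show ?thesis by blast
qed

lemma hamiltonian_vector_field_exists:
  assumes F: "F \<in> smooth_functions A"
  obtains X where "X \<in> vector_fields A"
    "\<And>p w. w \<in> tangent_space A p \<Longrightarrow> \<Omega> p (X p) w = differential A F p w"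
proof -
  obtain X where X: "\<And>p. X p \<in> tangent_space A p"
    "\<And>p w. w \<in> tangent_space A p \<Longrightarrow> \<Omega> p (X p) w = differential A F p w"
    using tangent_vector_exists[OF F] by metis
  have "smooth_on (chart_image c) (\<lambda>x. X (chart_inv c x) c)" if c: "c \<in> A" for c
  proof -
    note ch = is_chart[OF c]
    let ?F = "F \<circ> chart_inv c"
    have oW: "open (chart_image c)" using chart_image_open[OF ch] .
    have sF: "smooth_on (chart_image c) ?F"
      using F c unfolding smooth_functions_iff[OF atlas] by (simp add: o_def)
    show ?thesis
    proof (rule smooth_on_linear_solution[where L = "flat c"
          and b = "\<lambda>x. \<Sum>i\<in>Basis. frechet_derivative ?F (at x) i *\<^sub>R i", OF oW])
      show "smooth_on (chart_image c) (\<lambda>x. \<Sum>i\<in>Basis. frechet_derivative ?F (at x) i *\<^sub>R i)"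
        by (intro smooth_on_sum smooth_on_bounded_linear[OF bounded_linear_scaleR_left]
            smooth_on_frechet_derivative sF oW)
      fix x assume x: "x \<in> chart_image c"
      let ?p = "chart_inv c x"
      have p: "?p \<in> fst c" using chart_inv_domain[OF ch x] .
      note t = coord_vector_in_tangent_space[OF manifold c p]
      have "form2_coord A \<Omega> c x (X ?p c) i = frechet_derivative ?F (at x) i" for i
        using X(2)[OF t] form_eq_form2_coord[OF c p X(1) t] differential_in_chart[OF manifold F c p t]
        by (simp add: coord_vector_self[OF manifold c p] chart_chart_inv[OF ch x])
      then show "flat c x (X ?p c) = (\<Sum>i\<in>Basis. frechet_derivative ?F (at x) i *\<^sub>R i)"
        unfolding flat_def by simp
    qed (use c flat_linear flat_inj flat_smooth in auto)
  qed
  with X show thesis by (intro that[of X]) (auto simp: vector_fields_def)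
qed

lemma
  assumes F: "F \<in> smooth_functions A"
  shows hamiltonian_vector_field_smooth: "hamiltonian_vector_field A \<Omega> F \<in> vector_fields A" (is ?s)
    and hamiltonian_vector_field_eq: "w \<in> tangent_space A p \<Longrightarrow>
      \<Omega> p (hamiltonian_vector_field A \<Omega> F p) w = differential A F p w"
proof -
  obtain X where X: "X \<in> vector_fields A"
    "\<And>p w. w \<in> tangent_space A p \<Longrightarrow> \<Omega> p (X p) w = differential A F p w"
    using hamiltonian_vector_field_exists[OF F] by blast
  have "hamiltonian_vector_field A \<Omega> F = X"
    unfolding hamiltonian_vector_field_def
  proof (rule the_equality)
    fix Y assume Y: "Y \<in> vector_fields A \<and>
      (\<forall>p. \<forall>w\<in>tangent_space A p. \<Omega> p (Y p) w = differential A F p w)"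
    show "Y = X"
    proof
      show "Y p = X p" for p
        by (rule tangent_vector_unique[of _ p]) (use X Y in \<open>auto simp: vector_fields_def\<close>)
    qed
  qed (use X in blast)
  with X show ?s "w \<in> tangent_space A p \<Longrightarrow>
      \<Omega> p (hamiltonian_vector_field A \<Omega> F p) w = differential A F p w" by auto
qed

lemma hamiltonian_vector_field_tangent:
  "F \<in> smooth_functions A \<Longrightarrow> hamiltonian_vector_field A \<Omega> F p \<in> tangent_space A p"
  using hamiltonian_vector_field_smooth unfolding vector_fields_def by blast

lemma symplectic_bracket_eq_differential:
  "F \<in> smooth_functions A \<Longrightarrow> G \<in> smooth_functions A \<Longrightarrow>
    symplectic_bracket A \<Omega> F G p = differential A F p (hamiltonian_vector_field A \<Omega> G p)"
  unfolding symplectic_bracket_def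
  by (rule hamiltonian_vector_field_eq) (auto intro: hamiltonian_vector_field_tangent)

lemma symplectic_bracket_antisym:
  "F \<in> smooth_functions A \<Longrightarrow> G \<in> smooth_functions A \<Longrightarrow>
    symplectic_bracket A \<Omega> F G = (\<lambda>p. - symplectic_bracket A \<Omega> G F p)"
  unfolding symplectic_bracket_def
  using form_antisym hamiltonian_vector_field_tangent by blast

context
  fixes c F
  assumes c: "c \<in> A" and F: "F \<in> smooth_functions A"
begin

lemma function_in_chart_smooth: "smooth_on (chart_image c) (F \<circ> chart_inv c)"
  using F c unfolding smooth_functions_iff[OF atlas] by (simp add: o_def)

lemma hamiltonian_in_chart_smooth:
  "smooth_on (chart_image c) (\<lambda>x. hamiltonian_vector_field A \<Omega> F (chart_inv c x) c)"
  using hamiltonian_vector_field_smooth[OF F] c unfolding vector_fields_def by blast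

lemma hamiltonian_in_chart:
  assumes x: "x \<in> chart_image c"
  shows "form2_coord A \<Omega> c x (hamiltonian_vector_field A \<Omega> F (chart_inv c x) c) v =
    frechet_derivative (F \<circ> chart_inv c) (at x) v"
proof -
  have p: "chart_inv c x \<in> fst c" using chart_inv_domain[OF is_chart[OF c] x] .
  note t = coord_vector_in_tangent_space[OF manifold c p]
  show ?thesis
    using hamiltonian_vector_field_eq[OF F t]
      form_eq_form2_coord[OF c p hamiltonian_vector_field_tangent[OF F] t]
      differential_in_chart[OF manifold F c p t]
    by (simp add: coord_vector_self[OF manifold c p] chart_chart_inv[OF is_chart[OF c] x])
qed

lemma bracket_in_chart:
  assumes G: "G \<in> smooth_functions A" and x: "x \<in> chart_image c"
  shows "symplectic_bracket A \<Omega> F G (chart_inv c x) =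
    frechet_derivative (F \<circ> chart_inv c) (at x) (hamiltonian_vector_field A \<Omega> G (chart_inv c x) c)"
  using differential_in_chart[OF manifold F c chart_inv_domain[OF is_chart[OF c] x]
      hamiltonian_vector_field_tangent[OF G]]
  by (simp add: symplectic_bracket_eq_differential[OF F G] chart_chart_inv[OF is_chart[OF c] x])

end

lemma symplectic_bracket_smooth:
  assumes F: "F \<in> smooth_functions A" and G: "G \<in> smooth_functions A"
  shows "symplectic_bracket A \<Omega> F G \<in> smooth_functions A"
  unfolding smooth_functions_iff[OF atlas]
proof
  fix c assume c: "c \<in> A"
  have oW: "open (chart_image c)" using chart_image_open[OF is_chart[OF c]] .
  note sF = function_in_chart_smooth[OF c F]
  have "smooth_on (chart_image c) (\<lambda>x. frechet_derivative (F \<circ> chart_inv c) (at x)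
      (hamiltonian_vector_field A \<Omega> G (chart_inv c x) c))"
    by (rule smooth_on_linear_apply[OF oW _ smooth_on_frechet_derivative[OF sF]
          hamiltonian_in_chart_smooth[OF c G]])
      (rule linear_frechet_derivative[OF smooth_on_differentiable[OF sF]])
  then show "smooth_on (chart_image c) (\<lambda>x. symplectic_bracket A \<Omega> F G (chart_inv c x))"
    by (rule smooth_on_cong[OF oW, rotated]) (simp add: bracket_in_chart[OF c F G])
qed

lemma symplectic_bracket_jacobi:
  assumes F: "F \<in> smooth_functions A" and G: "G \<in> smooth_functions A" and H: "H \<in> smooth_functions A"
  defines "B \<equiv> symplectic_bracket A \<Omega>"
  shows "B F (B G H) p + B G (B H F) p + B H (B F G) p = 0"
proof -
  obtain c where c: "c \<in> A" "p \<in> fst c" using topological_atlas_chart_around[OF atlas] by blast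
  note ch = is_chart[OF c(1)]
  let ?x = "snd c p" and ?\<omega> = "form2_coord A \<Omega> c"
  let ?X = "\<lambda>F x. hamiltonian_vector_field A \<Omega> F (chart_inv c x) c"
  have x: "?x \<in> chart_image c" and px: "chart_inv c ?x = p"
    using chart_in_image[OF ch c(2)] chart_inv_chart[OF ch c(2)] by auto
  have oW: "open (chart_image c)" using chart_image_open[OF ch] .
  \<comment> \<open>The inner bracket is differentiated along the Hamiltonian vector field of the outer function.\<close>
  have br: "B F (B G H) p = - frechet_derivative (\<lambda>y. ?\<omega> y (?X G y) (?X H y)) (at ?x) (?X F ?x)"
    if F: "F \<in> smooth_functions A" and G: "G \<in> smooth_functions A" and H: "H \<in> smooth_functions A"
    for F G H
  proof -
    have GH: "B G H \<in> smooth_functions A" unfolding B_def by (rule symplectic_bracket_smooth[OF G H])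
    have "B F (B G H) p = - B (B G H) F p"
      unfolding B_def using symplectic_bracket_antisym[OF F] GH[unfolded B_def] by metis
    also have "B (B G H) F p = frechet_derivative (B G H \<circ> chart_inv c) (at ?x) (?X F ?x)"
      using bracket_in_chart[OF c(1) GH F x] unfolding B_def px .
    also have "frechet_derivative (B G H \<circ> chart_inv c) (at ?x) =
        frechet_derivative (\<lambda>y. ?\<omega> y (?X G y) (?X H y)) (at ?x)"
      by (rule frechet_derivative_transform_within_open[OF
            smooth_on_differentiable[OF function_in_chart_smooth[OF c(1) GH] x] oW x])
        (simp add: B_def bracket_in_chart[OF c(1) G H] hamiltonian_in_chart[OF c(1) G])
    finally show ?thesis .
  qed
  have "frechet_derivative (\<lambda>y. ?\<omega> y (?X G y) (?X H y)) (at ?x) (?X F ?x) +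
    frechet_derivative (\<lambda>y. ?\<omega> y (?X H y) (?X F y)) (at ?x) (?X G ?x) +
    frechet_derivative (\<lambda>y. ?\<omega> y (?X F y) (?X G y)) (at ?x) (?X H ?x) = 0"
  proof (rule jacobi_in_coordinates[where \<omega> = ?\<omega> and F = "F \<circ> chart_inv c" and G = "G \<circ> chart_inv c"
        and H = "H \<circ> chart_inv c", OF oW x])
    show "frechet_derivative (\<lambda>y. ?\<omega> y v w) (at ?x) u + frechet_derivative (\<lambda>y. ?\<omega> y w u) (at ?x) v +
        frechet_derivative (\<lambda>y. ?\<omega> y u v) (at ?x) w = 0" for u v w
      using form2_coord_closed[OF c(1) x] unfolding ext_deriv_coord_def .
  qed (intro form2_coord_linear_left[OF c(1)] form2_coord_linear_right[OF c(1)]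
      form2_coord_antisym[OF c(1)] form2_coord_smooth[OF c(1)] function_in_chart_smooth[OF c(1)]
      hamiltonian_in_chart_smooth[OF c(1)] hamiltonian_in_chart[OF c(1)] F G H; assumption)+
  then show ?thesis
    by (simp add: br[OF F G H] br[OF G H F] br[OF H F G])
qed

lemmas smooth_functions_ops = smooth_functions_add[OF atlas] smooth_functions_scale[OF atlas]
  smooth_functions_mult[OF atlas]

lemma
  assumes F: "F \<in> smooth_functions A" and G: "G \<in> smooth_functions A" and v: "v \<in> tangent_space A p"
  shows differential_add: "differential A (\<lambda>p. F p + G p) p v = differential A F p v + differential A G p v"
    and differential_scale: "differential A (\<lambda>p. r * F p) p v = r * differential A F p v"
    and differential_mult: "differential A (\<lambda>p. F p * G p) p v =
      F p * differential A G p v + differential A F p v * G p"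
proof -
  obtain c where c: "c \<in> A" "p \<in> fst c" using topological_atlas_chart_around[OF atlas] by blast
  let ?x = "snd c p"
  have D: "(H \<circ> chart_inv c has_derivative frechet_derivative (H \<circ> chart_inv c) (at ?x)) (at ?x)"
    if "H \<in> smooth_functions A" for H
    using has_frechet_derivative[OF smooth_function_differentiable[OF manifold that c]] .
  note ch = differential_in_chart[OF manifold _ c v]
  have px: "chart_inv c ?x = p" using chart_inv_chart[OF is_chart[OF c(1)] c(2)] .
  show "differential A (\<lambda>p. F p + G p) p v = differential A F p v + differential A G p v"
    using frechet_derivative_eqI[OF has_derivative_add[OF D[OF F] D[OF G]]]
    by (simp add: ch F G smooth_functions_ops o_def)
  show "differential A (\<lambda>p. r * F p) p v = r * differential A F p v"
    using frechet_derivative_eqI[OF has_derivative_mult_right[OF D[OF F], of r]]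
    by (simp add: ch F smooth_functions_ops o_def)
  show "differential A (\<lambda>p. F p * G p) p v = F p * differential A G p v + differential A F p v * G p"
    using frechet_derivative_eqI[OF has_derivative_mult[OF D[OF F] D[OF G]]]
    by (simp add: ch F G smooth_functions_ops o_def px)
qed

lemma
  assumes F: "F \<in> smooth_functions A" and G: "G \<in> smooth_functions A" and H: "H \<in> smooth_functions A"
  shows symplectic_bracket_add: "symplectic_bracket A \<Omega> (\<lambda>p. F p + G p) H =
      (\<lambda>p. symplectic_bracket A \<Omega> F H p + symplectic_bracket A \<Omega> G H p)"
    and symplectic_bracket_scale: "symplectic_bracket A \<Omega> (\<lambda>p. r * F p) H =
      (\<lambda>p. r * symplectic_bracket A \<Omega> F H p)"
    and symplectic_bracket_leibniz: "symplectic_bracket A \<Omega> F (\<lambda>p. G p * H p) =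
      (\<lambda>p. symplectic_bracket A \<Omega> F G p * H p + G p * symplectic_bracket A \<Omega> F H p)"
proof -
  note tan = hamiltonian_vector_field_tangent
  note ops = smooth_functions_ops
  show "symplectic_bracket A \<Omega> (\<lambda>p. F p + G p) H =
      (\<lambda>p. symplectic_bracket A \<Omega> F H p + symplectic_bracket A \<Omega> G H p)"
    by (rule ext) (simp add: symplectic_bracket_eq_differential ops differential_add tan F G H)
  show "symplectic_bracket A \<Omega> (\<lambda>p. r * F p) H = (\<lambda>p. r * symplectic_bracket A \<Omega> F H p)"
    by (rule ext) (simp add: symplectic_bracket_eq_differential ops differential_scale[OF F F] tan F H)
  have "symplectic_bracket A \<Omega> (\<lambda>p. G p * H p) F p =
      G p * symplectic_bracket A \<Omega> H F p + symplectic_bracket A \<Omega> G F p * H p" for p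
    by (simp add: symplectic_bracket_eq_differential ops differential_mult tan F G H)
  then show "symplectic_bracket A \<Omega> F (\<lambda>p. G p * H p) =
      (\<lambda>p. symplectic_bracket A \<Omega> F G p * H p + G p * symplectic_bracket A \<Omega> F H p)"
    unfolding symplectic_bracket_antisym[OF F ops(3)[OF G H]]
      symplectic_bracket_antisym[OF F G] symplectic_bracket_antisym[OF F H]
    by (simp add: algebra_simps)
qed

end

section \<open>Invariance of the bracket under symplectic maps\<close>

lemma differential_compose:
  assumes M: "smooth_manifold M" and N: "smooth_manifold N" and f: "smooth_map_on M N UNIV f"
    and h: "h \<in> smooth_functions N" and v: "v \<in> tangent_space M p"
  shows "differential M (h \<circ> f) p v = differential N h (f p) (tangent_map M N f p v)"
proof -
  obtain c where c: "c \<in> M" "p \<in> fst c"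
    using topological_atlas_chart_around[OF smooth_manifold_topological_atlas[OF M]] by blast
  obtain d where d: "d \<in> N" "f p \<in> fst d"
    using topological_atlas_chart_around[OF smooth_manifold_topological_atlas[OF N]] by blast
  have ch: "is_chart c" "is_chart d" using c d M N manifold_is_chart by blast+
  have pc: "chart_inv c (snd c p) = p" using chart_inv_chart[OF ch(1) c(2)] .
  let ?f = "snd d \<circ> f \<circ> chart_inv c" and ?h = "h \<circ> chart_inv d"
  have df: "?f differentiable (at (snd c p))"
    using smooth_on_differentiable[OF smooth_map_onD[OF f c(1) d(1)]] c(2) d(2) by (simp add: o_def)
  have dh: "?h differentiable (at (?f (snd c p)))"
    using smooth_function_differentiable[OF N h d] pc by simp
  have "((\<lambda>x. ?h (?f x)) has_derivative (\<lambda>u. frechet_derivative ?h (at (?f (snd c p)))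
      (frechet_derivative ?f (at (snd c p)) u))) (at (snd c p))"
    by (rule has_derivative_compose[OF has_frechet_derivative[OF df] has_frechet_derivative[OF dh]])
  then have "((h \<circ> f \<circ> chart_inv c) has_derivative (\<lambda>u. frechet_derivative ?h (at (?f (snd c p)))
      (frechet_derivative ?f (at (snd c p)) u))) (at (snd c p))"
  proof (rule has_derivative_transform_within_open)
    show "open (snd c ` (fst c \<inter> UNIV \<inter> f -` fst d))"
      using smooth_map_on_domain_open[OF ch _ open_UNIV] f unfolding smooth_map_on_def by blast
  qed (use c d in \<open>auto simp: chart_inv_chart[OF ch(1)] chart_inv_chart[OF ch(2)]\<close>)
  from frechet_derivative_eqI[OF this]
  have 1: "frechet_derivative (h \<circ> f \<circ> chart_inv c) (at (snd c p)) (v c) =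
      frechet_derivative ?h (at (snd d (f p))) (frechet_derivative ?f (at (snd c p)) (v c))"
    using pc by simp
  have hf: "h \<circ> f \<in> smooth_functions M"
    by (rule smooth_functions_compose[OF smooth_manifold_topological_atlas[OF M]
          smooth_manifold_topological_atlas[OF N] f h])
  show ?thesis
    unfolding differential_in_chart[OF M hf c v]
      differential_in_chart[OF N h d tangent_map_in_tangent_space[OF M N f v]]
      tangent_map_in_chart[OF M f c v d] by (rule 1)
qed

text \<open>
  The tangent map of a map preserving \<open>\<Omega>\<close> is injective because \<open>\<Omega>\<close> is nondegenerate, and it acts
  between spaces of the same finite dimension.
\<close>

lemma (in symplectic_manifold) symplectic_map_tangent_map_surj:
  assumes f: "smooth_map_on A A UNIV f"
    and pres: "\<And>v w. v \<in> tangent_space A p \<Longrightarrow> w \<in> tangent_space A p \<Longrightarrow>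
      pullback_form2 A A f \<Omega> p v w = \<Omega> p v w"
    and w: "w \<in> tangent_space A (f p)"
  obtains v where "v \<in> tangent_space A p" "tangent_map A A f p v = w"
proof -
  obtain c where c: "c \<in> A" "p \<in> fst c" using topological_atlas_chart_around[OF atlas] by blast
  obtain d where d: "d \<in> A" "f p \<in> fst d" using topological_atlas_chart_around[OF atlas] by blast
  define D where "D = frechet_derivative (snd d \<circ> f \<circ> chart_inv c) (at (snd c p))"
  note t = coord_vector_in_tangent_space[OF manifold c]
  note T = tangent_map_in_tangent_space[OF manifold manifold f]
  have Td: "tangent_map A A f p v d = D (v c)" if "v \<in> tangent_space A p" for v
    unfolding D_def by (rule tangent_map_in_chart[OF manifold f c that d])
  have "(snd d \<circ> f \<circ> chart_inv c) differentiable (at (snd c p))"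
    using smooth_on_differentiable[OF smooth_map_onD[OF f c(1) d(1)]] c(2) d(2) by (simp add: o_def)
  then have D: "linear D" unfolding D_def by (rule linear_frechet_derivative)
  have "u = 0" if "D u = 0" for u
  proof -
    let ?v = "coord_vector A c p u"
    have "\<Omega> p ?v w = 0" if w: "w \<in> tangent_space A p" for w
    proof -
      have "\<Omega> p ?v w = \<Omega> (f p) (tangent_map A A f p ?v) (tangent_map A A f p w)"
        using pres[OF t w] by (simp add: pullback_form2_def)
      also have "\<dots> = form2_coord A \<Omega> d (snd d (f p)) 0 (tangent_map A A f p w d)"
        using form_eq_form2_coord[OF d T[OF t] T[OF w]] Td[OF t] \<open>D u = 0\<close>
        by (simp add: coord_vector_self[OF manifold c])
      also have "\<dots> = 0"
        using linear_0[OF form2_coord_linear_left[OF d(1) chart_in_image[OF is_chart[OF d(1)] d(2)]]] .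
      finally show ?thesis .
    qed
    from form_nondegenerate[OF t this] have "?v c = 0" by simp
    then show ?thesis by (simp add: coord_vector_self[OF manifold c])
  qed
  then have "inj D" unfolding linear_injective_0[OF D] by blast
  then have "surj D" by (rule linear_injective_imp_surjective[OF D]) simp
  then obtain u where u: "D u = w d" by (metis surjD)
  have "tangent_map A A f p (coord_vector A c p u) = w"
    by (rule tangent_eqI[OF manifold d T[OF t] w]) (simp add: Td[OF t] u coord_vector_self[OF manifold c])
  with t that show thesis by blast
qed

text \<open>
  Both sides have the same pairing with every vector in the image of the tangent map, which is the
  whole tangent space.
\<close>

lemma (in symplectic_manifold) hamiltonian_vector_field_invariant:
  assumes f: "smooth_map_on A A UNIV f"
    and pres: "\<And>v w. v \<in> tangent_space A p \<Longrightarrow> w \<in> tangent_space A p \<Longrightarrow>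
      pullback_form2 A A f \<Omega> p v w = \<Omega> p v w"
    and F: "F \<in> smooth_functions A" "F \<circ> f = F"
  shows "hamiltonian_vector_field A \<Omega> F (f p) =
    tangent_map A A f p (hamiltonian_vector_field A \<Omega> F p)"
proof (rule tangent_vector_unique[of _ "f p"])
  note X = hamiltonian_vector_field_tangent[OF F(1)]
  show "hamiltonian_vector_field A \<Omega> F (f p) \<in> tangent_space A (f p)"
    "tangent_map A A f p (hamiltonian_vector_field A \<Omega> F p) \<in> tangent_space A (f p)"
    using X tangent_map_in_tangent_space[OF manifold manifold f] by auto
  fix w assume w: "w \<in> tangent_space A (f p)"
  obtain v where v: "v \<in> tangent_space A p" "tangent_map A A f p v = w"
    using symplectic_map_tangent_map_surj[OF f pres w] by blast
  have "\<Omega> (f p) (hamiltonian_vector_field A \<Omega> F (f p)) w = differential A F p v"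
    using hamiltonian_vector_field_eq[OF F(1) w]
      differential_compose[OF manifold manifold f F(1) v(1)] F(2) v(2) by simp
  also have "\<dots> = \<Omega> (f p) (tangent_map A A f p (hamiltonian_vector_field A \<Omega> F p)) w"
    using hamiltonian_vector_field_eq[OF F(1) v(1)] pres[OF X v(1)] v(2)
    by (simp add: pullback_form2_def)
  finally show "\<Omega> (f p) (hamiltonian_vector_field A \<Omega> F (f p)) w =
      \<Omega> (f p) (tangent_map A A f p (hamiltonian_vector_field A \<Omega> F p)) w" .
qed

lemma (in symplectic_manifold) symplectic_bracket_invariant:
  assumes f: "smooth_map_on A A UNIV f"
    and pres: "\<And>v w. v \<in> tangent_space A p \<Longrightarrow> w \<in> tangent_space A p \<Longrightarrow>
      pullback_form2 A A f \<Omega> p v w = \<Omega> p v w"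
    and F: "F \<in> smooth_functions A" "F \<circ> f = F" and G: "G \<in> smooth_functions A" "G \<circ> f = G"
  shows "symplectic_bracket A \<Omega> F G (f p) = symplectic_bracket A \<Omega> F G p"
proof -
  have "hamiltonian_vector_field A \<Omega> H (f p) = tangent_map A A f p (hamiltonian_vector_field A \<Omega> H p)"
    if "H \<in> smooth_functions A" "H \<circ> f = H" for H
    by (rule hamiltonian_vector_field_invariant[OF f pres that])
  then show ?thesis
    using pres[OF hamiltonian_vector_field_tangent[OF F(1)] hamiltonian_vector_field_tangent[OF G(1)]] F G
    unfolding symplectic_bracket_def pullback_form2_def by simp
qed

section \<open>Principal bundles of the additive reals\<close>

text \<open>A principal bundle \<open>\<mu>\<close> with action \<open>\<psi>\<close>, regardless of any symplectic form.\<close>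

locale R_bundle =
  fixes A :: "('a::{t2_space,second_countable_topology}, 'e::euclidean_space) chart set"
    and V :: "('v::{t2_space,second_countable_topology}, 'f::euclidean_space) chart set"
    and \<mu> :: "'a \<Rightarrow> 'v" and \<psi> :: "real \<Rightarrow> 'a \<Rightarrow> 'a"
  assumes principal_bundle: "principal_R_bundle A V \<mu> \<psi>"
begin

lemma total_manifold: "smooth_manifold A" and base_manifold: "smooth_manifold V"
  and projection_smooth: "smooth_map_on A V UNIV \<mu>"
  and projection_action: "\<mu> (\<psi> s a) = \<mu> a"
  using principal_bundle unfolding principal_R_bundle_def by blast+

lemmas total_atlas = smooth_manifold_topological_atlas[OF total_manifold]
  and base_atlas = smooth_manifold_topological_atlas[OF base_manifold]

lemma action_smooth: "smooth_map_on A A UNIV (\<psi> s)"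
proof -
  have "smooth_map_on A (prod_atlas real_atlas A) UNIV (\<lambda>a. (s, a))"
    by (rule smooth_map_on_Pair[OF total_atlas topological_atlas_real total_atlas open_UNIV
          smooth_map_on_const smooth_map_on_ident[OF total_manifold]])
  from smooth_map_on_compose[OF total_atlas topological_atlas_prod[OF topological_atlas_real total_atlas]
      total_atlas this open_UNIV _ open_UNIV, of "\<lambda>(s, a). \<psi> s a"]
  show ?thesis using principal_bundle unfolding principal_R_bundle_def by (simp add: o_def)
qed

lemma local_trivialization:
  obtains U \<Phi> where "open U" "y \<in> U"
    "diffeomorphism_on A (prod_atlas V real_atlas) (\<mu> -` U) (U \<times> UNIV) \<Phi>"
    "\<And>a. \<mu> a \<in> U \<Longrightarrow> fst (\<Phi> a) = \<mu> a"
    "\<And>a s. \<mu> a \<in> U \<Longrightarrow> snd (\<Phi> (\<psi> s a)) = s + snd (\<Phi> a)"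
proof -
  have "\<exists>U \<Phi>. open U \<and> y \<in> U \<and>
        diffeomorphism_on A (prod_atlas V real_atlas) (\<mu> -` U) (U \<times> UNIV) \<Phi> \<and>
        (\<forall>a\<in>\<mu> -` U. fst (\<Phi> a) = \<mu> a \<and> (\<forall>s. snd (\<Phi> (\<psi> s a)) = s + snd (\<Phi> a)))"
    using principal_bundle unfolding principal_R_bundle_def by blast
  then show thesis using that by (metis vimageI2)
qed

text \<open>
  In a trivialization the action translates the real coordinate, so the difference of the coordinates
  of two points in a fibre is the required group element.
\<close>

lemma fibre_eq_orbit:
  assumes "\<mu> a = \<mu> b"
  obtains s where "b = \<psi> s a"
proof -
  obtain U \<Phi> where U: "\<mu> a \<in> U" "diffeomorphism_on A (prod_atlas V real_atlas) (\<mu> -` U) (U \<times> UNIV) \<Phi>"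
    "\<And>a. \<mu> a \<in> U \<Longrightarrow> fst (\<Phi> a) = \<mu> a"
    "\<And>a s. \<mu> a \<in> U \<Longrightarrow> snd (\<Phi> (\<psi> s a)) = s + snd (\<Phi> a)"
    using local_trivialization[of "\<mu> a"] by metis
  define s where "s = snd (\<Phi> b) - snd (\<Phi> a)"
  have "inj_on \<Phi> (\<mu> -` U)" using U(2) unfolding diffeomorphism_on_def bij_betw_def by blast
  moreover have "\<Phi> b = \<Phi> (\<psi> s a)"
    using U(1) assms by (intro prod_eqI) (simp_all add: U(3,4) projection_action s_def)
  ultimately have "b = \<psi> s a"
    using U(1) assms by (auto dest!: inj_onD simp: projection_action)
  with that show thesis .
qed

text \<open>The zero section of a local trivialization.\<close>

lemma local_section:
  obtains U \<sigma> where "open U" "y \<in> U" "smooth_map_on V A U \<sigma>" "\<And>z. z \<in> U \<Longrightarrow> \<mu> (\<sigma> z) = z"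
proof -
  obtain U \<Phi> where U: "open U" "y \<in> U"
    "diffeomorphism_on A (prod_atlas V real_atlas) (\<mu> -` U) (U \<times> UNIV) \<Phi>"
    "\<And>a. \<mu> a \<in> U \<Longrightarrow> fst (\<Phi> a) = \<mu> a"
    using local_trivialization[of y] by metis
  let ?I = "inv_into (\<mu> -` U) \<Phi>"
  have im: "\<Phi> ` (\<mu> -` U) = U \<times> UNIV" and I: "smooth_map_on (prod_atlas V real_atlas) A (U \<times> UNIV) ?I"
    using U(3) unfolding diffeomorphism_on_def bij_betw_def by auto
  have "smooth_map_on V (prod_atlas V real_atlas) U (\<lambda>z. (z, 0))"
    by (rule smooth_map_on_Pair[OF base_atlas base_atlas topological_atlas_real U(1)
          smooth_map_on_ident[OF base_manifold] smooth_map_on_const])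
  from smooth_map_on_compose[OF base_atlas topological_atlas_prod[OF base_atlas topological_atlas_real]
      total_atlas this U(1) I open_Times[OF U(1) open_UNIV]]
  have "smooth_map_on V A U (\<lambda>z. ?I (z, 0))" by (auto simp: o_def)
  moreover have "\<mu> (?I (z, 0)) = z" if "z \<in> U" for z
  proof -
    have z: "(z, 0) \<in> \<Phi> ` (\<mu> -` U)" using that im by blast
    have "\<mu> (?I (z, 0)) \<in> U" using inv_into_into[OF z] by simp
    then show ?thesis using U(4) f_inv_into_f[OF z] by fastforce
  qed
  ultimately show thesis using that U(1,2) by blast
qed

lemma projection_surj: obtains a where "\<mu> a = y"
  using local_section[of y] by metis

lemma pullback_smooth: "f \<in> smooth_functions V \<Longrightarrow> f \<circ> \<mu> \<in> smooth_functions A"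
  by (rule smooth_functions_compose[OF total_atlas base_atlas projection_smooth])

lemma pullback_inject: "f \<circ> \<mu> = g \<circ> \<mu> \<Longrightarrow> f = g"
  by (metis comp_apply ext projection_surj)

text \<open>The induced function is smooth because it is locally \<open>k \<circ> \<sigma>\<close> for a smooth local section \<open>\<sigma>\<close>.\<close>

lemma invariant_function_descends:
  assumes k: "k \<in> smooth_functions A" and inv: "\<And>s a. k (\<psi> s a) = k a"
  obtains h where "h \<in> smooth_functions V" "h \<circ> \<mu> = k"
proof -
  define h where "h y = k (SOME a. \<mu> a = y)" for y
  have h: "h (\<mu> a) = k a" for a
  proof -
    have "\<mu> (SOME b. \<mu> b = \<mu> a) = \<mu> a" by (rule someI) simp
    then show ?thesis unfolding h_def using fibre_eq_orbit inv by metis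
  qed
  have "smooth_on (chart_image d) (\<lambda>x. h (chart_inv d x))" if d: "d \<in> V" for d
  proof (rule smooth_on_local)
    fix x assume x: "x \<in> chart_image d"
    have ch: "is_chart d" using manifold_is_chart[OF base_manifold d] .
    obtain U \<sigma> where U: "open U" "chart_inv d x \<in> U" "smooth_map_on V A U \<sigma>"
      "\<And>z. z \<in> U \<Longrightarrow> \<mu> (\<sigma> z) = z"
      using local_section[of "chart_inv d x"] by metis
    let ?T = "snd d ` (fst d \<inter> U)"
    have oT: "open ?T" by (rule chart_image_Int_open[OF ch U(1)])
    have "smooth_map_on V real_atlas U (k \<circ> \<sigma>)"
      by (rule smooth_map_on_compose[OF base_atlas total_atlas topological_atlas_real U(3,1) _ open_UNIV])
        (use k in \<open>auto simp: smooth_functions_def\<close>)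
    from smooth_map_onD[OF this d, of "(UNIV, id)"]
    have "smooth_on ?T (\<lambda>y. k (\<sigma> (chart_inv d y)))" by (simp add: real_atlas_def)
    then have "smooth_on ?T (\<lambda>y. h (chart_inv d y))"
    proof (rule smooth_on_cong[OF oT, rotated])
      fix y assume "y \<in> ?T"
      then have "chart_inv d y \<in> U" using chart_inv_chart[OF ch] by auto
      then show "k (\<sigma> (chart_inv d y)) = h (chart_inv d y)" using h U(4) by metis
    qed
    moreover have "x \<in> ?T" using x U(2) unfolding chart_image_Int[OF ch] by blast
    ultimately show "\<exists>T. open T \<and> x \<in> T \<and> smooth_on T (\<lambda>y. h (chart_inv d y))" using oT by blast
  qed
  then have "h \<in> smooth_functions V" unfolding smooth_functions_iff[OF base_atlas] by blast
  moreover have "h \<circ> \<mu> = k" using h by (simp add: fun_eq_iff)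
  ultimately show thesis using that by blast
qed

end

section \<open>The Poisson structure on the base\<close>

theorem proposition3p5:
  fixes A :: "('a::{t2_space,second_countable_topology}, 'e::euclidean_space) chart set"
    and \<Omega> :: "('a, 'e) form2"
    and V :: "('v::{t2_space,second_countable_topology}, 'f::euclidean_space) chart set"
    and \<mu> :: "'a \<Rightarrow> 'v"
    and \<psi> :: "real \<Rightarrow> 'a \<Rightarrow> 'a"
  assumes "symplectic_principal_R_bundle A \<Omega> V \<mu> \<psi>"
  shows "\<exists>!B. poisson_structure V B \<and>
    (\<forall>f\<in>smooth_functions V. \<forall>f'\<in>smooth_functions V.
       symplectic_bracket A \<Omega> (f \<circ> \<mu>) (f' \<circ> \<mu>) = B f f' \<circ> \<mu>)"
proof -
  interpret R_bundle A V \<mu> \<psi>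
    using assms unfolding symplectic_principal_R_bundle_def by unfold_locales blast
  interpret symplectic_manifold A \<Omega>
    using assms total_manifold unfolding symplectic_principal_R_bundle_def by unfold_locales blast+
  have pres: "pullback_form2 A A (\<psi> s) \<Omega> p v w = \<Omega> p v w"
    if "v \<in> tangent_space A p" "w \<in> tangent_space A p" for s p v w
    using assms that unfolding symplectic_principal_R_bundle_def by blast
  let ?S = "smooth_functions V" and ?b = "symplectic_bracket A \<Omega>"
  have desc: "\<exists>h\<in>?S. ?b (f \<circ> \<mu>) (g \<circ> \<mu>) = h \<circ> \<mu>" if f: "f \<in> ?S" and g: "g \<in> ?S" for f g
  proof -
    have inv: "(f \<circ> \<mu>) \<circ> \<psi> s = f \<circ> \<mu>" for f :: "'v \<Rightarrow> real" and s
      by (simp add: fun_eq_iff projection_action)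
    have "?b (f \<circ> \<mu>) (g \<circ> \<mu>) (\<psi> s a) = ?b (f \<circ> \<mu>) (g \<circ> \<mu>) a" for s a
      by (rule symplectic_bracket_invariant[OF action_smooth pres pullback_smooth[OF f] inv
            pullback_smooth[OF g] inv])
    from invariant_function_descends[OF symplectic_bracket_smooth[OF pullback_smooth[OF f]
          pullback_smooth[OF g]] this]
    show ?thesis by metis
  qed
  define B where "B = (\<lambda>f\<in>?S. \<lambda>g\<in>?S. SOME h. h \<in> ?S \<and> ?b (f \<circ> \<mu>) (g \<circ> \<mu>) = h \<circ> \<mu>)"
  have B: "B f g \<in> ?S" "B f g \<circ> \<mu> = ?b (f \<circ> \<mu>) (g \<circ> \<mu>)" if "f \<in> ?S" "g \<in> ?S" for f g
  proof -
    have "\<exists>h. h \<in> ?S \<and> ?b (f \<circ> \<mu>) (g \<circ> \<mu>) = h \<circ> \<mu>" using desc[OF that] by blast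
    from someI_ex[OF this] show "B f g \<in> ?S" "B f g \<circ> \<mu> = ?b (f \<circ> \<mu>) (g \<circ> \<mu>)"
      unfolding B_def using that by auto
  qed
  have Bp: "B f g (\<mu> a) = ?b (f \<circ> \<mu>) (g \<circ> \<mu>) a" if "f \<in> ?S" "g \<in> ?S" for f g a
    using fun_cong[OF B(2)[OF that], of a] by simp
  have eqI: "f = g" if "\<And>a. f (\<mu> a) = g (\<mu> a)" for f g :: "'v \<Rightarrow> real"
    using pullback_inject that by (metis comp_apply ext)
  have "poisson_structure V B"
    unfolding poisson_structure_def
  proof (intro conjI ballI allI)
    show "B \<in> ?S \<rightarrow>\<^sub>E ?S \<rightarrow>\<^sub>E ?S"
      using B(1) by (auto simp: B_def intro!: PiE_I)
    fix f g h :: "'v \<Rightarrow> real" and r :: real and x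
    assume S: "f \<in> ?S" "g \<in> ?S" "h \<in> ?S"
    note P = pullback_smooth[OF S(1)] pullback_smooth[OF S(2)] pullback_smooth[OF S(3)]
    have add: "(\<lambda>x. f x + g x) \<in> ?S" and scale: "(\<lambda>x. r * f x) \<in> ?S" and mult: "(\<lambda>x. g x * h x) \<in> ?S"
      using S smooth_functions_add[OF base_atlas] smooth_functions_scale[OF base_atlas]
        smooth_functions_mult[OF base_atlas] by auto
    show "B (\<lambda>x. f x + g x) h = (\<lambda>x. B f h x + B g h x)"
      using symplectic_bracket_add[OF P]
      by (intro eqI) (simp add: Bp S add o_def)
    show "B (\<lambda>x. r * f x) h = (\<lambda>x. r * B f h x)"
      using symplectic_bracket_scale[OF P]
      by (intro eqI) (simp add: Bp S scale o_def)
    show "B f g = (\<lambda>x. - B g f x)"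
      using symplectic_bracket_antisym[OF P(1,2)]
      by (intro eqI) (simp add: Bp S)
    show "B f (\<lambda>x. g x * h x) = (\<lambda>x. B f g x * h x + g x * B f h x)"
      using symplectic_bracket_leibniz[OF P]
      by (intro eqI) (simp add: Bp S mult o_def)
    obtain a where a: "\<mu> a = x" using projection_surj .
    show "B f (B g h) x + B g (B h f) x + B h (B f g) x = 0"
      unfolding a[symmetric] using symplectic_bracket_jacobi[OF P, of a]
      by (simp add: Bp S B)
  qed
  moreover have "B' = B"
    if B': "poisson_structure V B'" "\<forall>f\<in>?S. \<forall>g\<in>?S. ?b (f \<circ> \<mu>) (g \<circ> \<mu>) = B' f g \<circ> \<mu>" for B'
  proof -
    have *: "B' \<in> ?S \<rightarrow>\<^sub>E ?S \<rightarrow>\<^sub>E ?S" "B \<in> ?S \<rightarrow>\<^sub>E ?S \<rightarrow>\<^sub>E ?S"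
      using B'(1) \<open>poisson_structure V B\<close> unfolding poisson_structure_def by blast+
    show ?thesis
    proof (rule PiE_ext[OF *])
      fix f assume f: "f \<in> ?S"
      show "B' f = B f"
      proof (rule PiE_ext[OF PiE_mem[OF *(1) f] PiE_mem[OF *(2) f]])
        show "B' f g = B f g" if "g \<in> ?S" for g
          using B'(2) f that B(2)[OF f that] by (intro pullback_inject) simp
      qed
    qed
  qed
  moreover have "\<forall>f\<in>?S. \<forall>g\<in>?S. ?b (f \<circ> \<mu>) (g \<circ> \<mu>) = B f g \<circ> \<mu>"
    using B(2) by simp
  ultimately show ?thesis by (intro ex1I[of _ B] conjI) (assumption | elim conjE)+
qed

end
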